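(* Let $A_0\in\mathfrak{gl}_n(\mathbb{R})$ be such that the solvable Lie group $G_{\mu_{A_0}}$ admits a left-invariant Riemannian metric with negative curvature. If $\mu_{A(t)}$ is the bracket flow starting at $\mu_{A_0}$, then there exists $s_0\in\mathbb{R}$ such that $K_{A(t)}<0$ for all $t\ge s_0$.
   Context: Let $n\ge1$ and equip $\mathbb{R}^{n+1}=\mathbb{R}e_0\oplus\mathbb{R}^n$ with the canonical inner product $\langle\cdot,\cdot\rangle$ and canonical basis $e_0,e_1,\dots,e_n$. For $A\in\mathfrak{gl}_n(\mathbb{R})$, $\mu_A$ is the Lie bracket on $\mathbb{R}^{n+1}$ given by $\mu_A(e_0,e_i)=Ae_i$ and $\mu_A(e_i,e_j)=0$ for $i,j\ge1$, where $A$ acts on $\mathbb{R}^n=\langle e_1,\dots,e_n\rangle$. $G_{\mu_A}$ is the simply connected Lie group with Lie algebra $(\mathbb{R}^{n+1},\mu_A)$ and $g_{\mu_A}$ is the left-invariant Riemannian metric on it equal to $\langle\cdot,\cdot\rangle$ at the identity. $K_A$ denotes the sectional curvature of $(G_{\mu_A},g_{\mu_A})$. A Riemannian manifold has negative curvature, written $K<0$, if all its sectional curvatures are strictly negative. The bracket flow starting at $\mu_{A_0}$ is $\mu_{A(t)}$, where $A(t)$ is the solution (defined for all $t\ge0$) of $$\tfrac{d}{dt}A=-\operatorname{tr}(S(A)^2)A+\tfrac12[A,[A,A^t]]-\tfrac12\operatorname{tr}(A)[A,A^t],\quad A(0)=A_0,\qquad S(A)=\tfrac12(A+A^t).$$ (For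 each $t$, the Ricci flow solution $g(t)$ starting at $g_{\mu_{A_0}}$ is isometric to $g_{\mu_{A(t)}}$.) *)

theory Defs
  imports "HOL-Analysis.Analysis"
begin

section \<open>The matrix exponential\<close>

text \<open>The product and the powers which the type class instances provide on \<^typ>\<open>real^'n^'n\<close> are
  componentwise, so neither \<^const>\<open>power\<close> nor \<^const>\<open>exp\<close> can be used here.\<close>

definition matpow :: "real^'n^'n \<Rightarrow> nat \<Rightarrow> real^'n^'n" where
  "matpow A k = (((**) A) ^^ k) (mat 1)"

definition mexp :: "real^'n^'n \<Rightarrow> real^'n^'n" where
  "mexp A = (\<Sum>k. (1 / fact k) *\<^sub>R matpow A k)"

lemma matpow_0 [simp]: "matpow A 0 = mat 1"
  by (simp add: matpow_def)

lemma matpow_Suc: "matpow A (Suc k) = A ** matpow A k"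
  by (simp add: matpow_def)

lemma matpow_Suc2: "matpow A (Suc k) = matpow A k ** A"
proof (induction k)
  case (Suc k)
  have "matpow A (Suc (Suc k)) = A ** matpow A (Suc k)" by (rule matpow_Suc)
  also have "\<dots> = (A ** matpow A k) ** A" by (simp only: Suc matrix_mul_assoc)
  finally show ?case by (simp only: matpow_Suc)
qed (simp add: matpow_Suc)

lemma matpow_scaleR: "matpow (s *\<^sub>R A) k = s ^ k *\<^sub>R matpow A k"
proof (induction k)
  case (Suc k)
  have "(s *\<^sub>R A) ** (s ^ k *\<^sub>R matpow A k) = s ^ Suc k *\<^sub>R (A ** matpow A k)"
    by (simp add: vec_eq_iff matrix_matrix_mult_def sum_distrib_left mult_ac)
  then show ?case by (simp only: matpow_Suc Suc)
qed simp

lemma matpow_entry_bound: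
  fixes A :: "real^'n^'n"
  obtains c where "c \<ge> 0" "\<And>k i j. \<bar>matpow A k $ i $ j\<bar> \<le> c ^ k"
proof -
  obtain c where c: "c > 0" "\<And>x. norm (A *v x) \<le> norm x * c"
    using bounded_linear.pos_bounded[OF matrix_vector_mul_bounded_linear[of A]] by blast
  have b: "norm (matpow A k *v x) \<le> c ^ k * norm x" for k x
  proof (induction k)
    case (Suc k)
    have "norm (matpow A (Suc k) *v x) = norm (A *v (matpow A k *v x))"
      by (simp add: matpow_Suc matrix_vector_mul_assoc)
    also have "\<dots> \<le> norm (matpow A k *v x) * c" by (rule c)
    also have "\<dots> \<le> (c ^ k * norm x) * c" using Suc c by (intro mult_right_mono) auto
    finally show ?case by (simp add: mult_ac)
  qed simp
  have "\<bar>matpow A k $ i $ j\<bar> \<le> c ^ k" for k i j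
  proof -
    have "matpow A k $ i $ j = (matpow A k *v axis j 1) $ i"
      by (simp add: matrix_vector_mul_component matrix_vector_mult_basis column_def)
    then have "\<bar>matpow A k $ i $ j\<bar> \<le> norm (matpow A k *v axis j 1)"
      by (metis component_le_norm_cart)
    also have "\<dots> \<le> c ^ k" using b[of k "axis j 1"] by (simp add: norm_axis_1)
    finally show ?thesis .
  qed
  then show ?thesis using that[of c] c(1) by simp
qed

lemma matpow_entry_summable:
  "summable (\<lambda>k. (matpow A k $ i $ j / fact k) * (x::real) ^ k)"
proof -
  obtain c where c: "c \<ge> 0" "\<And>k i j. \<bar>matpow A k $ i $ j\<bar> \<le> c ^ k"
    using matpow_entry_bound[of A] by metis
  have "summable (\<lambda>k. inverse (fact k) * (c * \<bar>x\<bar>) ^ k)" by (rule summable_exp)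
  moreover have "norm (matpow A k $ i $ j / fact k * x ^ k) \<le> inverse (fact k) * (c * \<bar>x\<bar>) ^ k" for k
  proof -
    have "norm (matpow A k $ i $ j / fact k * x ^ k) = \<bar>matpow A k $ i $ j\<bar> * (\<bar>x\<bar> ^ k / fact k)"
      by (simp add: abs_mult power_abs)
    also have "\<dots> \<le> c ^ k * (\<bar>x\<bar> ^ k / fact k)"
      by (rule mult_right_mono[OF c(2)]) simp
    also have "\<dots> = inverse (fact k) * (c * \<bar>x\<bar>) ^ k"
      by (simp add: power_mult_distrib divide_inverse)
    finally show ?thesis .
  qed
  ultimately show ?thesis by (rule summable_comparison_test'[where N = 0])
qed

lemma mexp_sums_entry:
  fixes A :: "real^'n^'n"
  shows "(\<lambda>k. (matpow A k $ i $ j / fact k) * s ^ k) sums (mexp (s *\<^sub>R A) $ i $ j)"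
proof -
  define E :: "real^'n^'n" where "E = (\<chi> i j. \<Sum>k. (matpow A k $ i $ j / fact k) * s ^ k)"
  have "(\<lambda>k. (1 / fact k) *\<^sub>R matpow (s *\<^sub>R A) k) sums E"
    unfolding sums_def
  proof (intro vec_tendstoI)
    fix i j
    have "(\<lambda>k. (matpow A k $ i $ j / fact k) * s ^ k) sums (E $ i $ j)"
      using summable_sums[OF matpow_entry_summable] by (simp add: E_def)
    then show "(\<lambda>n. (\<Sum>k<n. (1 / fact k) *\<^sub>R matpow (s *\<^sub>R A) k) $ i $ j) \<longlonglongrightarrow> E $ i $ j"
      by (simp add: sums_def matpow_scaleR sum_component mult_ac)
  qed
  then have "mexp (s *\<^sub>R A) = E"
    unfolding mexp_def by (rule sums_unique[symmetric])
  then show ?thesis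
    using summable_sums[OF matpow_entry_summable] by (simp add: E_def)
qed

lemma mexp_0 [simp]: "mexp (0 :: real^'n^'n) = mat 1"
proof -
  have "mexp (0 :: real^'n^'n) $ i $ j = mat 1 $ i $ j" for i j
  proof -
    have "(\<lambda>k. (matpow 0 k $ i $ j / fact k) * (0::real) ^ k) sums (matpow 0 0 $ i $ j / fact 0)"
      by (rule powser_sums_zero)
    then have "mexp (0 *\<^sub>R 0 :: real^'n^'n) $ i $ j = matpow 0 0 $ i $ j / fact 0"
      by (rule sums_unique2[OF mexp_sums_entry])
    then show ?thesis by simp
  qed
  then show ?thesis unfolding vec_eq_iff by blast
qed

lemma mexp_commute: "A ** mexp (s *\<^sub>R A) = mexp (s *\<^sub>R A) ** A"
proof -
  have "(A ** mexp (s *\<^sub>R A)) $ i $ j = (mexp (s *\<^sub>R A) ** A) $ i $ j" for i j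
  proof -
    have "(\<lambda>k. \<Sum>l\<in>UNIV. A $ i $ l * ((matpow A k $ l $ j / fact k) * s ^ k))
        sums (\<Sum>l\<in>UNIV. A $ i $ l * mexp (s *\<^sub>R A) $ l $ j)"
      by (intro sums_sum sums_mult mexp_sums_entry)
    moreover have "(\<lambda>k. \<Sum>l\<in>UNIV. ((matpow A k $ i $ l / fact k) * s ^ k) * A $ l $ j)
        sums (\<Sum>l\<in>UNIV. mexp (s *\<^sub>R A) $ i $ l * A $ l $ j)"
      by (intro sums_sum sums_mult2 mexp_sums_entry)
    moreover have "(\<Sum>l\<in>UNIV. A $ i $ l * ((matpow A k $ l $ j / fact k) * s ^ k))
       = (\<Sum>l\<in>UNIV. ((matpow A k $ i $ l / fact k) * s ^ k) * A $ l $ j)" for k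
    proof -
      have "(A ** matpow A k) $ i $ j = (matpow A k ** A) $ i $ j"
        by (metis matpow_Suc matpow_Suc2)
      then have "(\<Sum>l\<in>UNIV. A $ i $ l * matpow A k $ l $ j) * (s ^ k / fact k)
          = (\<Sum>l\<in>UNIV. matpow A k $ i $ l * A $ l $ j) * (s ^ k / fact k)"
        by (simp add: matrix_matrix_mult_def)
      then show ?thesis unfolding sum_distrib_right by (simp add: mult_ac)
    qed
    ultimately show ?thesis
      by (simp add: matrix_matrix_mult_def sums_unique2)
  qed
  then show ?thesis by (simp add: vec_eq_iff)
qed

lemma mexp_entry_deriv:
  "((\<lambda>s. mexp (s *\<^sub>R A) $ i $ j) has_real_derivative (A ** mexp (s *\<^sub>R A)) $ i $ j) (at s)"
proof -
  let ?c = "\<lambda>k. matpow A k $ i $ j / fact k"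
  have "(\<lambda>k. diffs ?c k * s ^ k) sums (\<Sum>l\<in>UNIV. A $ i $ l * mexp (s *\<^sub>R A) $ l $ j)"
  proof -
    have "(\<lambda>k. \<Sum>l\<in>UNIV. A $ i $ l * ((matpow A k $ l $ j / fact k) * s ^ k))
        sums (\<Sum>l\<in>UNIV. A $ i $ l * mexp (s *\<^sub>R A) $ l $ j)"
      by (intro sums_sum sums_mult mexp_sums_entry)
    moreover have "(\<Sum>l\<in>UNIV. A $ i $ l * ((matpow A k $ l $ j / fact k) * s ^ k))
        = diffs ?c k * s ^ k" for k
    proof -
      have "diffs ?c k = matpow A (Suc k) $ i $ j / fact k"
        by (simp add: diffs_def field_simps del: of_nat_Suc)
      then have "(\<Sum>l\<in>UNIV. A $ i $ l * matpow A k $ l $ j) * (s ^ k / fact k) = diffs ?c k * s ^ k"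
        by (simp add: matpow_Suc matrix_matrix_mult_def)
      then show ?thesis unfolding sum_distrib_right by (simp add: mult_ac)
    qed
    ultimately show ?thesis by simp
  qed
  then have eq: "(\<Sum>k. diffs ?c k * s ^ k) = (A ** mexp (s *\<^sub>R A)) $ i $ j"
    by (simp add: sums_iff matrix_matrix_mult_def)
  have "((\<lambda>x. \<Sum>k. ?c k * x ^ k) has_real_derivative (\<Sum>k. diffs ?c k * s ^ k)) (at s)"
    by (rule termdiffs_strong_converges_everywhere) (rule matpow_entry_summable)
  moreover have "(\<Sum>k. ?c k * x ^ k) = mexp (x *\<^sub>R A) $ i $ j" for x
    using mexp_sums_entry[of A i j x] by (simp add: sums_iff)
  ultimately show ?thesis by (simp add: eq)
qed

lemma mexp_has_vector_derivative:
  fixes A :: "real^'n^'n"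
  shows "((\<lambda>s. mexp (s *\<^sub>R A)) has_vector_derivative A ** mexp (s *\<^sub>R A)) (at s)"
proof -
  have "((\<lambda>s. mexp (s *\<^sub>R A)) has_derivative (\<lambda>h. h *\<^sub>R (A ** mexp (s *\<^sub>R A)))) (at s)"
  proof (subst has_derivative_componentwise_within, intro ballI)
    fix b :: "real^'n^'n" assume "b \<in> Basis"
    then obtain i j where b: "b = axis i (axis j 1)" by (auto simp: Basis_vec_def)
    show "((\<lambda>s. mexp (s *\<^sub>R A) \<bullet> b) has_derivative (\<lambda>h. h *\<^sub>R (A ** mexp (s *\<^sub>R A)) \<bullet> b)) (at s)"
      using mexp_entry_deriv[of A i j s]
      by (simp add: b inner_axis has_field_derivative_def mult_commute_abs)
  qed
  then show ?thesis by (simp add: has_vector_derivative_def)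
qed

lemma bounded_bilinear_matrix_mult:
  "bounded_bilinear ((**) :: real^'n^'m \<Rightarrow> real^'k^'n \<Rightarrow> real^'k^'m)"
proof (rule bilinear_conv_bounded_bilinear[THEN iffD1])
  have "(A + B) ** C = A ** C + B ** C" for A B :: "real^'n^'m" and C :: "real^'k^'n"
    by (simp add: vec_eq_iff matrix_matrix_mult_def distrib_right sum.distrib)
  then show "bilinear ((**) :: real^'n^'m \<Rightarrow> real^'k^'n \<Rightarrow> real^'k^'m)"
    by (simp add: bilinear_def linear_iff matrix_add_ldistrib scalar_matrix_assoc matrix_scalar_ac)
qed

lemma mexp_uminus_add: "mexp (- s *\<^sub>R A) ** mexp ((s + t) *\<^sub>R A) = mexp (t *\<^sub>R A)"
proof -
  let ?G = "\<lambda>s. mexp (- s *\<^sub>R A) ** mexp ((s + t) *\<^sub>R A)"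
  have "(?G has_vector_derivative 0) (at s)" for s
  proof -
    have 1: "((\<lambda>s. mexp (- s *\<^sub>R A)) has_vector_derivative - (A ** mexp (- s *\<^sub>R A))) (at s)"
    proof -
      have "(uminus has_vector_derivative (-1::real)) (at s)"
        by (auto intro!: derivative_eq_intros)
      from vector_diff_chain_at[OF this mexp_has_vector_derivative] show ?thesis
        by (simp add: o_def)
    qed
    have 2: "((\<lambda>s. mexp ((s + t) *\<^sub>R A)) has_vector_derivative (A ** mexp ((s + t) *\<^sub>R A))) (at s)"
    proof -
      have "((\<lambda>s. s + t) has_vector_derivative (1::real)) (at s)"
        by (auto intro!: derivative_eq_intros)
      from vector_diff_chain_at[OF this mexp_has_vector_derivative] show ?thesis
        by (simp add: o_def)
    qed
    have "mexp (- s *\<^sub>R A) ** (A ** mexp ((s + t) *\<^sub>R A))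
        = (A ** mexp (- s *\<^sub>R A)) ** mexp ((s + t) *\<^sub>R A)"
      by (metis matrix_mul_assoc mexp_commute)
    then have "mexp (- s *\<^sub>R A) ** (A ** mexp ((s + t) *\<^sub>R A))
        + (- (A ** mexp (- s *\<^sub>R A))) ** mexp ((s + t) *\<^sub>R A) = 0"
      by (simp add: bounded_bilinear.minus_left[OF bounded_bilinear_matrix_mult])
    with bounded_bilinear.has_vector_derivative[OF bounded_bilinear_matrix_mult 1 2]
    show ?thesis by simp
  qed
  then have "\<exists>c. \<forall>s. ?G s = c"
    by (metis (no_types, lifting) UNIV_I convex_UNIV has_vector_derivative_zero_constant)
  then have "?G s = ?G 0" by metis
  then show ?thesis by simp
qed

lemma mexp_add: "mexp ((s + t) *\<^sub>R A) = mexp (s *\<^sub>R A) ** mexp (t *\<^sub>R A)"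
proof -
  have "mexp (s *\<^sub>R A) ** mexp (- s *\<^sub>R A) = mat 1"
    using mexp_uminus_add[of "- s" A 0] by simp
  then show ?thesis
    by (metis mexp_uminus_add matrix_mul_assoc matrix_mul_lid)
qed


section \<open>The simply connected Lie group with Lie algebra \<open>\<mu>\<^sub>A\<close>\<close>

text \<open>\<open>\<real>\<^sup>n\<^sup>+\<^sup>1 = \<real>e\<^sub>0 \<oplus> \<real>\<^sup>n\<close> is \<^typ>\<open>real \<times> (real^'n)\<close> with its standard inner product; \<open>e\<^sub>0 = (1, 0)\<close>.\<close>

definition mu :: "real^'n^'n \<Rightarrow> real \<times> (real^'n) \<Rightarrow> real \<times> (real^'n) \<Rightarrow> real \<times> (real^'n)" where
  "mu A X Y = (0, fst X *\<^sub>R (A *v snd Y) - fst Y *\<^sub>R (A *v snd X))"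

text \<open>The group is \<open>\<real> \<ltimes> \<real>\<^sup>n\<close>, where \<open>s \<in> \<real>\<close> acts on \<open>\<real>\<^sup>n\<close> by \<open>exp (sA)\<close>. The underlying manifold
  is the vector space itself, so it is simply connected, and the identity element is \<open>0\<close>.
  That \<open>mu A\<close> is the bracket of the left-invariant vector fields is \<open>left_inv_field_bracket\<close> below.\<close>

definition gmult :: "real^'n^'n \<Rightarrow> real \<times> (real^'n) \<Rightarrow> real \<times> (real^'n) \<Rightarrow> real \<times> (real^'n)" where
  "gmult A p q = (fst p + fst q, snd p + mexp (fst p *\<^sub>R A) *v snd q)"

definition ginv :: "real^'n^'n \<Rightarrow> real \<times> (real^'n) \<Rightarrow> real \<times> (real^'n)" where
  "ginv A p = (- fst p, - (mexp (- fst p *\<^sub>R A) *v snd p))"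

definition left_inv_field :: "real^'n^'n \<Rightarrow> real \<times> (real^'n) \<Rightarrow> real \<times> (real^'n) \<Rightarrow> real \<times> (real^'n)" where
  "left_inv_field A X p = frechet_derivative (gmult A p) (at 0) X"

lemma gmult_assoc: "gmult A (gmult A p q) r = gmult A p (gmult A q r)"
  by (simp add: gmult_def mexp_add matrix_vector_mul_assoc matrix_vector_right_distrib)

lemma gmult_0_left [simp]: "gmult A 0 p = p"
  by (simp add: gmult_def)

lemma gmult_0_right [simp]: "gmult A p 0 = p"
  by (simp add: gmult_def)

lemma gmult_ginv_left: "gmult A (ginv A p) p = 0"
  by (simp add: gmult_def ginv_def zero_prod_def)

lemma gmult_ginv_right: "gmult A p (ginv A p) = 0"
proof -
  have "mexp (fst p *\<^sub>R A) ** mexp (- fst p *\<^sub>R A) = mat 1"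
    using mexp_add[of "fst p" "- fst p" A] by simp
  then show ?thesis
    by (simp add: gmult_def ginv_def zero_prod_def linear_neg[OF matrix_vector_mul_linear] matrix_vector_mul_assoc)
qed

lemma gmult_has_derivative:
  "(gmult A q has_derivative (\<lambda>u. (fst u, mexp (fst q *\<^sub>R A) *v snd u))) (at p)"
proof -
  have "((\<lambda>x. mexp (fst q *\<^sub>R A) *v snd x) has_derivative (\<lambda>u. mexp (fst q *\<^sub>R A) *v snd u)) (at p)"
    by (intro bounded_linear.has_derivative[OF matrix_vector_mul_bounded_linear] derivative_intros)
  then show ?thesis
    unfolding gmult_def by (auto intro!: derivative_eq_intros)
qed

lemma frechet_derivative_gmult:
  "frechet_derivative (gmult A q) (at p) = (\<lambda>u. (fst u, mexp (fst q *\<^sub>R A) *v snd u))"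
  by (rule frechet_derivative_at[OF gmult_has_derivative, symmetric])

lemma left_inv_field_eq: "left_inv_field A X p = (fst X, mexp (fst p *\<^sub>R A) *v snd X)"
  by (simp add: left_inv_field_def frechet_derivative_gmult)

lemma bounded_bilinear_matrix_vector_mult:
  "bounded_bilinear ((*v) :: real^'n^'m \<Rightarrow> real^'n \<Rightarrow> real^'m)"
  by (rule bilinear_conv_bounded_bilinear[THEN iffD1])
    (simp add: bilinear_def linear_iff matrix_vector_right_distrib matrix_vector_mult_add_rdistrib
      matrix_vector_mult_scaleR flip: scaleR_matrix_vector_assoc)

lemma left_inv_field_has_derivative:
  "(left_inv_field A X has_derivative
     (\<lambda>u. (0, fst u *\<^sub>R ((A ** mexp (fst p *\<^sub>R A)) *v snd X)))) (at p)"
proof -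
  have 1: "((\<lambda>s. mexp (s *\<^sub>R A)) has_derivative (\<lambda>h. h *\<^sub>R (A ** mexp (fst p *\<^sub>R A)))) (at (fst p))"
    using mexp_has_vector_derivative by (simp add: has_vector_derivative_def)
  have "((\<lambda>p. mexp (fst p *\<^sub>R A)) has_derivative (\<lambda>u. fst u *\<^sub>R (A ** mexp (fst p *\<^sub>R A)))) (at p)"
    using diff_chain_at[OF bounded_linear_imp_has_derivative[OF bounded_linear_fst] 1]
    by (simp add: o_def)
  then have "((\<lambda>p. mexp (fst p *\<^sub>R A) *v snd X) has_derivative
      (\<lambda>u. (fst u *\<^sub>R (A ** mexp (fst p *\<^sub>R A))) *v snd X)) (at p)"
    by (rule bounded_linear.has_derivative
        [OF bounded_bilinear.bounded_linear_left[OF bounded_bilinear_matrix_vector_mult]])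
  then show ?thesis
    unfolding left_inv_field_eq [abs_def]
    by (auto simp flip: scaleR_matrix_vector_assoc intro!: derivative_eq_intros)
qed

lemma left_inv_field_bracket:
  "frechet_derivative (left_inv_field A Y) (at p) (left_inv_field A X p)
     - frechet_derivative (left_inv_field A X) (at p) (left_inv_field A Y p)
   = left_inv_field A (mu A X Y) p"
proof -
  have *: "frechet_derivative (left_inv_field A X) (at p)
      = (\<lambda>u. (0, fst u *\<^sub>R ((A ** mexp (fst p *\<^sub>R A)) *v snd X)))" for X
    by (rule frechet_derivative_at[OF left_inv_field_has_derivative, symmetric])
  show ?thesis
    unfolding *
    by (simp add: left_inv_field_eq mu_def mexp_commute matrix_vector_mul_assoc
        matrix_vector_mult_diff_distrib matrix_vector_mult_scaleR)
qed


section \<open>Riemannian metrics in a global chart\<close>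

primrec continuously_differentiable :: "nat \<Rightarrow> ('a::euclidean_space \<Rightarrow> real) \<Rightarrow> bool" where
  "continuously_differentiable 0 f \<longleftrightarrow> continuous_on UNIV f"
| "continuously_differentiable (Suc k) f \<longleftrightarrow>
     (\<forall>p. f differentiable (at p)) \<and>
     (\<forall>u. continuously_differentiable k (\<lambda>p. frechet_derivative f (at p) u))"

lemma continuously_differentiable_add:
  "continuously_differentiable k f \<Longrightarrow> continuously_differentiable k g \<Longrightarrow>
     continuously_differentiable k (\<lambda>p. f p + g p)"
proof (induction k arbitrary: f g)
  case (Suc k)
  have d: "((\<lambda>p. f p + g p) has_derivative
      (\<lambda>u. frechet_derivative f (at p) u + frechet_derivative g (at p) u)) (at p)" for p
    using Suc.prems by (intro has_derivative_add) (simp_all flip: frechet_derivative_works)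
  then have "frechet_derivative (\<lambda>p. f p + g p) (at p)
      = (\<lambda>u. frechet_derivative f (at p) u + frechet_derivative g (at p) u)" for p
    by (rule frechet_derivative_at[symmetric])
  with d Suc show ?case by (auto simp: differentiable_def)
qed (simp add: continuous_on_add)

lemma continuously_differentiable_cmult:
  "continuously_differentiable k f \<Longrightarrow> continuously_differentiable k (\<lambda>p. c * f p)"
proof (induction k arbitrary: f)
  case (Suc k)
  have d: "((\<lambda>p. c * f p) has_derivative (\<lambda>u. c * frechet_derivative f (at p) u)) (at p)" for p
    using Suc.prems by (intro has_derivative_mult_right) (simp flip: frechet_derivative_works)
  then have "frechet_derivative (\<lambda>p. c * f p) (at p) = (\<lambda>u. c * frechet_derivative f (at p) u)" for p
    by (rule frechet_derivative_at[symmetric])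
  with d Suc show ?case by (auto simp: differentiable_def)
qed (simp add: continuous_on_mult_left)

lemma continuously_differentiable_const: "continuously_differentiable k (\<lambda>p. c)"
  by (induction k arbitrary: c) (simp_all add: frechet_derivative_const)

text \<open>A metric assigns to each point \<open>p\<close> a bilinear form \<open>g p\<close> on the tangent space at \<open>p\<close>, which is
  identified with the vector space itself.\<close>

definition riemannian_metric :: "('a::euclidean_space \<Rightarrow> 'a \<Rightarrow> 'a \<Rightarrow> real) \<Rightarrow> bool" where
  "riemannian_metric g \<longleftrightarrow>
     (\<forall>p. bilinear (g p) \<and> (\<forall>u v. g p u v = g p v u) \<and> (\<forall>u. u \<noteq> 0 \<longrightarrow> g p u u > 0)) \<and>
     (\<forall>u v k. continuously_differentiable k (\<lambda>p. g p u v))"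

text \<open>\<open>christoffel g p u v\<close> is the Levi-Civita derivative \<open>\<nabla>\<^sub>u v\<close> at \<open>p\<close>, where \<open>u\<close> and \<open>v\<close> are constant
  vector fields; since these commute, the defining equation is the Koszul formula.\<close>

definition christoffel :: "('a::euclidean_space \<Rightarrow> 'a \<Rightarrow> 'a \<Rightarrow> real) \<Rightarrow> 'a \<Rightarrow> 'a \<Rightarrow> 'a \<Rightarrow> 'a" where
  "christoffel g p u v = (THE w. \<forall>z. 2 * g p w z =
     frechet_derivative (\<lambda>q. g q v z) (at p) u
     + frechet_derivative (\<lambda>q. g q u z) (at p) v
     - frechet_derivative (\<lambda>q. g q u v) (at p) z)"

text \<open>\<open>R(u,v)w = \<nabla>\<^sub>u\<nabla>\<^sub>v w - \<nabla>\<^sub>v\<nabla>\<^sub>u w\<close> for constant fields, where \<open>\<nabla>\<^sub>u W = DW(u) + \<Gamma>(u,W)\<close>.\<close>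

definition curvature :: "('a::euclidean_space \<Rightarrow> 'a \<Rightarrow> 'a \<Rightarrow> real) \<Rightarrow> 'a \<Rightarrow> 'a \<Rightarrow> 'a \<Rightarrow> 'a \<Rightarrow> 'a" where
  "curvature g p u v w =
     frechet_derivative (\<lambda>q. christoffel g q v w) (at p) u
       + christoffel g p u (christoffel g p v w)
     - (frechet_derivative (\<lambda>q. christoffel g q u w) (at p) v
       + christoffel g p v (christoffel g p u w))"

definition sectional_curvature :: "('a::euclidean_space \<Rightarrow> 'a \<Rightarrow> 'a \<Rightarrow> real) \<Rightarrow> 'a \<Rightarrow> 'a \<Rightarrow> 'a \<Rightarrow> real" where
  "sectional_curvature g p u v =
     g p (curvature g p u v v) u / (g p u u * g p v v - (g p u v)\<^sup>2)"

definition negative_curvature :: "('a::euclidean_space \<Rightarrow> 'a \<Rightarrow> 'a \<Rightarrow> real) \<Rightarrow> bool" where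
  "negative_curvature g \<longleftrightarrow>
     (\<forall>p u v. u \<noteq> v \<and> independent {u, v} \<longrightarrow> sectional_curvature g p u v < 0)"


section \<open>Left-invariant metrics and the bracket flow\<close>

definition left_invariant ::
  "real^'n^'n \<Rightarrow> (real \<times> (real^'n) \<Rightarrow> real \<times> (real^'n) \<Rightarrow> real \<times> (real^'n) \<Rightarrow> real) \<Rightarrow> bool" where
  "left_invariant A g \<longleftrightarrow>
     (\<forall>q p u v. g (gmult A q p) (frechet_derivative (gmult A q) (at p) u)
                                (frechet_derivative (gmult A q) (at p) v) = g p u v)"

text \<open>The left-invariant metric which is the standard inner product at the identity, obtained by
  translating tangent vectors at \<open>p\<close> back to the identity.\<close>

definition gmetric :: "real^'n^'n \<Rightarrow> real \<times> (real^'n) \<Rightarrow> real \<times> (real^'n) \<Rightarrow> real \<times> (real^'n) \<Rightarrow> real" where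
  "gmetric A p u v = frechet_derivative (gmult A (ginv A p)) (at p) u
                       \<bullet> frechet_derivative (gmult A (ginv A p)) (at p) v"

lemma gmetric_eq:
  "gmetric A p u v = fst u * fst v
     + (mexp (- fst p *\<^sub>R A) *v snd u) \<bullet> (mexp (- fst p *\<^sub>R A) *v snd v)"
  by (simp add: gmetric_def frechet_derivative_gmult ginv_def inner_prod_def)

lemma gmetric_0: "gmetric A 0 u v = u \<bullet> v"
  by (simp add: gmetric_eq inner_prod_def)

lemma left_invariant_gmetric: "left_invariant A (gmetric A)"
  unfolding left_invariant_def gmetric_eq frechet_derivative_gmult
proof (intro allI, goal_cases)
  case (1 q p u v)
  have "mexp (- fst (gmult A q p) *\<^sub>R A) ** mexp (fst q *\<^sub>R A) = mexp (- fst p *\<^sub>R A)"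
    using mexp_add[of "- fst (gmult A q p)" "fst q" A] by (simp add: gmult_def)
  then show ?case by (simp add: matrix_vector_mul_assoc)
qed

lemma mexp_inner_has_derivative:
  fixes A :: "real^'n^'n"
  defines "f \<equiv> \<lambda>a b (p :: real \<times> (real^'n)). (mexp (- fst p *\<^sub>R A) *v a) \<bullet> (mexp (- fst p *\<^sub>R A) *v b)"
  shows "(f a b has_derivative (\<lambda>w. - fst w * (f (A *v a) b p + f a (A *v b) p))) (at p)"
proof -
  have 1: "((\<lambda>s. mexp (s *\<^sub>R A)) has_derivative (\<lambda>h. h *\<^sub>R (A ** mexp (- fst p *\<^sub>R A)))) (at (- fst p))"
    using mexp_has_vector_derivative[of A "- fst p"] by (simp add: has_vector_derivative_def)
  have "((\<lambda>p. - fst p) has_derivative (\<lambda>w. - fst w)) (at p)"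
    by (auto intro!: derivative_eq_intros)
  from diff_chain_at[OF this 1]
  have "((\<lambda>p. mexp (- fst p *\<^sub>R A)) has_derivative (\<lambda>w. - fst w *\<^sub>R (A ** mexp (- fst p *\<^sub>R A)))) (at p)"
    by (simp add: o_def)
  then have 2: "((\<lambda>p. mexp (- fst p *\<^sub>R A) *v x) has_derivative
      (\<lambda>w. (- fst w *\<^sub>R (A ** mexp (- fst p *\<^sub>R A))) *v x)) (at p)" for x
    by (rule bounded_linear.has_derivative
        [OF bounded_bilinear.bounded_linear_left[OF bounded_bilinear_matrix_vector_mult]])
  have 3: "(- fst w *\<^sub>R (A ** mexp (- fst p *\<^sub>R A))) *v x
      = - fst w *\<^sub>R (mexp (- fst p *\<^sub>R A) *v (A *v x))" for w :: "real \<times> (real^'n)" and x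
    by (metis mexp_commute matrix_vector_mul_assoc scaleR_matrix_vector_assoc)
  show ?thesis
    unfolding f_def
    by (rule has_derivative_eq_rhs[OF has_derivative_inner[OF 2 2]], unfold 3)
      (simp add: fun_eq_iff algebra_simps)
qed

lemma riemannian_metric_gmetric:
  fixes A :: "real^'n^'n"
  shows "riemannian_metric (gmetric A)"
proof -
  define f where "f = (\<lambda>a b (p :: real \<times> (real^'n)).
    (mexp (- fst p *\<^sub>R A) *v a) \<bullet> (mexp (- fst p *\<^sub>R A) *v b))"
  have d: "(f a b has_derivative (\<lambda>w. - fst w * (f (A *v a) b p + f a (A *v b) p))) (at p)" for a b p
    unfolding f_def by (rule mexp_inner_has_derivative)
  have fd: "frechet_derivative (f a b) (at p) = (\<lambda>w. - fst w * (f (A *v a) b p + f a (A *v b) p))" for a b p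
    by (rule frechet_derivative_at[OF d, symmetric])
  have diff: "f a b differentiable (at p)" for a b p
    using d unfolding differentiable_def by blast
  have smooth: "continuously_differentiable k (f a b)" for k a b
  proof (induction k arbitrary: a b)
    case 0
    show ?case
      unfolding continuously_differentiable.simps
      by (rule differentiable_imp_continuous_on) (simp add: differentiable_on_def diff)
  next
    case (Suc k)
    show ?case
      unfolding continuously_differentiable.simps fd
      by (intro conjI allI diff continuously_differentiable_cmult continuously_differentiable_add Suc)
  qed
  have eq: "gmetric A p u v = fst u * fst v + f (snd u) (snd v) p" for p u v
    by (simp add: gmetric_eq f_def)
  have "continuously_differentiable k (\<lambda>p. gmetric A p u v)" for k u v
    unfolding eq by (intro continuously_differentiable_add continuously_differentiable_const smooth)
  moreover have "bilinear (gmetric A p)" for p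
    by (simp add: bilinear_def linear_iff gmetric_eq algebra_simps)
  moreover have "gmetric A p u v = gmetric A p v u" for p u v
    by (simp add: gmetric_eq mult.commute inner_commute)
  moreover have "gmetric A p u u > 0" if "u \<noteq> 0" for p u
  proof (cases "fst u = 0")
    case True
    have "mexp (- fst p *\<^sub>R A) *v snd u \<noteq> 0"
    proof
      assume *: "mexp (- fst p *\<^sub>R A) *v snd u = 0"
      have "snd u = mexp (fst p *\<^sub>R A) *v (mexp (- fst p *\<^sub>R A) *v snd u)"
        using mexp_add[of "fst p" "- fst p" A, symmetric] by (simp add: matrix_vector_mul_assoc)
      then show False using that True * by (simp add: prod_eq_iff)
    qed
    then show ?thesis by (simp add: gmetric_eq True)
  next
    case False
    then have "fst u * fst u > 0" by (auto simp: zero_less_mult_iff linorder_neq_iff)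
    then show ?thesis unfolding gmetric_eq by (simp add: add_pos_nonneg)
  qed
  ultimately show ?thesis by (simp add: riemannian_metric_def)
qed

definition commutator :: "real^'n^'n \<Rightarrow> real^'n^'n \<Rightarrow> real^'n^'n" where
  "commutator A B = A ** B - B ** A"

definition sym_part :: "real^'n^'n \<Rightarrow> real^'n^'n" where
  "sym_part A = (1/2) *\<^sub>R (A + transpose A)"

definition bracket_flow_field :: "real^'n^'n \<Rightarrow> real^'n^'n" where
  "bracket_flow_field A =
     - trace (sym_part A ** sym_part A) *\<^sub>R A
     + (1/2) *\<^sub>R commutator A (commutator A (transpose A))
     - (trace A / 2) *\<^sub>R commutator A (transpose A)"

definition bracket_flow :: "real^'n^'n \<Rightarrow> (real \<Rightarrow> real^'n^'n) \<Rightarrow> bool" where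
  "bracket_flow A\<^sub>0 A \<longleftrightarrow> A 0 = A\<^sub>0 \<and>
     (\<forall>t\<ge>0. (A has_vector_derivative bracket_flow_field (A t)) (at t within {0..}))"

end

theory Submission
  imports Defs
begin

text \<open>
  A left-invariant metric on the group of \<open>A\<close> is an inner product on the Lie algebra, and its curvature
  on planes in the abelian ideal \<open>\<real>\<^sup>n\<close> is minus a positive multiple of a Gram determinant of the quadratic form
  \<open>P (A x, x)\<close>, where \<open>P\<close> is the inner product on the ideal.  Negative curvature therefore makes this form
  definite (\<open>Heintze_necessary\<close>); for \<open>n = 1\<close>, where the ideal contains no plane, it is enough that
  \<open>A \<noteq> 0\<close>, since \<open>A = 0\<close> gives a flat metric.  As the bracket flow is odd in \<open>A\<close>, it may be taken positive definite for
  \<open>A = A\<^sub>0\<close>; then \<open>P\<close> is a Lyapunov function, which excludes eigenvalues of \<open>A\<^sub>0\<close> with real part \<open>\<le> 0\<close>.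

  For the standard metric, with \<open>S\<close> the symmetric part of \<open>A\<close>, the curvature is negative as soon as \<open>S\<close> is
  definite and \<open>|S x|\<^sup>2 < 2\<langle>S x, A x\<rangle>\<close> for \<open>x \<noteq> 0\<close> (\<open>negative_curvature_gmetricI\<close>).  For a normal matrix the second
  condition follows from the first, since then \<open>\<langle>S x, A x\<rangle> = |S x|\<^sup>2\<close>; and the first holds if all
  eigenvalues have positive real part.  Both conditions are invariant under positive scaling.

  It remains to see that the flow, suitably scaled, approaches normal matrices without changing the
  spectrum.  After removal of the scaling term the flow is \<open>B' = \<mu>\<^sup>-\<^sup>2 (\<onehalf>[B, [B, B\<^sup>t]] - \<onehalf> tr B [B, B\<^sup>t])\<close>.
  It has the form \<open>B' = [B, V]\<close>, so the spectrum is preserved; this is expressed by the determinants of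
  \<open>(B - s)\<^sup>2 + c\<close>.  The norm of \<open>B\<close> decreases at the rate given by \<open>|[B, B\<^sup>t]|\<^sup>2\<close>, and \<open>|[B, B\<^sup>t]|\<close> is
  itself monotone, so that it tends to \<open>0\<close> (\<open>moment_decay\<close>).  Among the matrices of bounded norm with the
  spectrum of \<open>A\<^sub>0\<close> those which violate one of the two conditions stay away from the normal ones by compactness
  (\<open>small_moment_imp_negative_curvature_condition\<close>), so the flow leaves them for good.
\<close>

section \<open>Left-invariant metrics in the moving frame\<close>

text \<open>The inverse of \<^const>\<open>left_inv_field\<close>: it expresses a tangent vector at \<open>p\<close> in the left-invariant
  frame.  In this frame a left-invariant metric is one fixed inner product on the Lie algebra, and
  its connection and curvature are computed there algebraically.\<close>

definition coframe :: "real^'n^'n \<Rightarrow> real \<times> (real^'n) \<Rightarrow> real \<times> (real^'n) \<Rightarrow> real \<times> (real^'n)" where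
  "coframe A p u = (fst u, mexp (- fst p *\<^sub>R A) *v snd u)"

definition ad_e0 :: "real^'n^'n \<Rightarrow> real \<times> (real^'n) \<Rightarrow> real \<times> (real^'n)" where
  "ad_e0 A a = (0, A *v snd a)"

lemma left_inv_field_coframe [simp]: "left_inv_field A (coframe A p u) p = u"
proof -
  have "mexp (fst p *\<^sub>R A) ** mexp (- fst p *\<^sub>R A) = mat 1"
    using mexp_add[of "fst p" "- fst p" A] by simp
  then show ?thesis by (simp add: left_inv_field_eq coframe_def matrix_vector_mul_assoc)
qed

lemma coframe_left_inv_field [simp]: "coframe A p (left_inv_field A a p) = a"
proof -
  have "mexp (- fst p *\<^sub>R A) ** mexp (fst p *\<^sub>R A) = mat 1"
    using mexp_add[of "- fst p" "fst p" A] by simp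
  then show ?thesis by (simp add: left_inv_field_eq coframe_def matrix_vector_mul_assoc)
qed

lemma fst_coframe [simp]: "fst (coframe A p u) = fst u"
  by (simp add: coframe_def)

lemma coframe_at_0 [simp]: "coframe A 0 u = u"
  by (simp add: coframe_def)

lemma fst_left_inv_field [simp]: "fst (left_inv_field A a p) = fst a"
  by (simp add: left_inv_field_eq)

lemma linear_coframe: "linear (coframe A p)"
  by (simp add: linear_iff coframe_def matrix_vector_right_distrib matrix_vector_mult_scaleR)

lemma linear_ad_e0: "linear (ad_e0 A)"
  by (simp add: linear_iff ad_e0_def matrix_vector_right_distrib matrix_vector_mult_scaleR)

text \<open>The frame varies along \<open>e\<^sub>0\<close> only, and infinitesimally it does so by \<open>ad e\<^sub>0\<close>; this is the
  only source of derivatives in the curvature computation.\<close>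

lemma coframe_has_derivative:
  "((\<lambda>q. coframe A q u) has_derivative (\<lambda>w. - fst w *\<^sub>R ad_e0 A (coframe A p u))) (at p)"
proof -
  have "(uminus has_derivative uminus) (at p)"
    by (auto intro!: derivative_eq_intros)
  from diff_chain_at[OF this left_inv_field_has_derivative[of A u "- p"]]
  have "((\<lambda>q. left_inv_field A u (- q)) has_derivative
      (\<lambda>w. (0, - fst w *\<^sub>R ((A ** mexp (- fst p *\<^sub>R A)) *v snd u)))) (at p)"
    by (simp add: o_def)
  then show ?thesis
    by (simp add: left_inv_field_eq coframe_def ad_e0_def matrix_vector_mul_assoc)
qed

lemma mexp_fst_has_derivative:
  "((\<lambda>p. mexp (fst p *\<^sub>R A)) has_derivative (\<lambda>w. fst w *\<^sub>R (mexp (fst p *\<^sub>R A) ** A))) (at p)"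
proof -
  have 1: "((\<lambda>s. mexp (s *\<^sub>R A)) has_derivative (\<lambda>h. h *\<^sub>R (A ** mexp (fst p *\<^sub>R A)))) (at (fst p))"
    using mexp_has_vector_derivative by (simp add: has_vector_derivative_def)
  show ?thesis
    using diff_chain_at[OF bounded_linear_imp_has_derivative[OF bounded_linear_fst] 1]
    by (simp add: o_def mexp_commute)
qed

lemma left_inv_field_has_derivative_compose:
  assumes "(c has_derivative c') (at p)"
  shows "((\<lambda>q. left_inv_field A (c q) q) has_derivative
           (\<lambda>w. left_inv_field A (c' w + fst w *\<^sub>R ad_e0 A (c p)) p)) (at p)"
proof -
  have 1: "((\<lambda>q. snd (c q)) has_derivative (\<lambda>w. snd (c' w))) (at p)"
    by (rule has_derivative_snd[OF assms])
  have 2: "((\<lambda>q. fst (c q)) has_derivative (\<lambda>w. fst (c' w))) (at p)"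
    by (rule has_derivative_fst[OF assms])
  show ?thesis
    unfolding left_inv_field_eq
    by (rule has_derivative_eq_rhs, rule has_derivative_Pair[OF 2],
        rule bounded_bilinear.FDERIV[OF bounded_bilinear_matrix_vector_mult mexp_fst_has_derivative 1])
      (simp add: fun_eq_iff ad_e0_def matrix_vector_right_distrib matrix_vector_mult_scaleR
        matrix_vector_mul_assoc flip: scaleR_matrix_vector_assoc)
qed

text \<open>The inner product \<open>Q\<close> on the Lie algebra determines the metric, and \<open>\<Gamma>\<close> is its Levi-Civita
  product \<open>\<nabla>\<^sub>a b\<close>, expressed in the frame but taken between \<^emph>\<open>coordinate\<close> fields: these commute, so
  the bracket terms of the Koszul formula are absent, while their coefficients in the frame vary with
  derivative \<open>- ad e\<^sub>0\<close> along \<open>e\<^sub>0\<close>.  This makes \<open>\<Gamma>\<close> symmetric.\<close>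

locale left_inv_metric =
  fixes A :: "real^'n^'n"
    and Q :: "real \<times> (real^'n) \<Rightarrow> real \<times> (real^'n) \<Rightarrow> real"
    and \<Gamma> :: "real \<times> (real^'n) \<Rightarrow> real \<times> (real^'n) \<Rightarrow> real \<times> (real^'n)"
  assumes bilinear_Q: "bilinear Q"
    and Q_sym: "Q a b = Q b a"
    and Q_pos: "a \<noteq> 0 \<Longrightarrow> Q a a > 0"
    and bilinear_conn: "bilinear \<Gamma>"
    and koszul: "2 * Q (\<Gamma> a b) z =
        - fst a * (Q (ad_e0 A b) z + Q b (ad_e0 A z))
        - fst b * (Q (ad_e0 A a) z + Q a (ad_e0 A z))
        + fst z * (Q (ad_e0 A a) b + Q a (ad_e0 A b))"
begin

definition metric where
  "metric p u v = Q (coframe A p u) (coframe A p v)"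

lemma Q_left_eqI:
  assumes "\<And>z. Q a z = Q b z"
  shows "a = b"
proof (rule ccontr)
  assume "a \<noteq> b"
  then have "Q (a - b) (a - b) > 0" by (intro Q_pos) simp
  then show False using assms[of "a - b"] by (simp add: bilinear_lsub[OF bilinear_Q])
qed

lemma bounded_bilinear_Q: "bounded_bilinear Q"
  using bilinear_Q by (simp add: bilinear_conv_bounded_bilinear)

lemma bounded_bilinear_conn: "bounded_bilinear \<Gamma>"
  using bilinear_conn by (simp add: bilinear_conv_bounded_bilinear)

lemma frechet_derivative_metric:
  "frechet_derivative (\<lambda>q. metric q u v) (at p) w =
     - fst w * (Q (ad_e0 A (coframe A p u)) (coframe A p v) + Q (coframe A p u) (ad_e0 A (coframe A p v)))"
proof -
  have "((\<lambda>q. metric q u v) has_derivative (\<lambda>w.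
     - fst w * (Q (ad_e0 A (coframe A p u)) (coframe A p v) + Q (coframe A p u) (ad_e0 A (coframe A p v))))) (at p)"
    unfolding metric_def
    by (rule has_derivative_eq_rhs,
        rule bounded_bilinear.FDERIV[OF bounded_bilinear_Q coframe_has_derivative coframe_has_derivative])
      (simp add: fun_eq_iff algebra_simps bilinear_lmul[OF bilinear_Q] bilinear_rmul[OF bilinear_Q] bilinear_lneg[OF bilinear_Q] bilinear_rneg[OF bilinear_Q])
  from frechet_derivative_at[OF this, symmetric] show ?thesis by simp
qed

lemma christoffel_metric:
  "christoffel metric p u v = left_inv_field A (\<Gamma> (coframe A p u) (coframe A p v)) p"
  unfolding christoffel_def frechet_derivative_metric
proof (rule the_equality, goal_cases)
  case 1
  show ?case
    by (simp add: metric_def koszul)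
next
  case (2 w)
  have "coframe A p w = \<Gamma> (coframe A p u) (coframe A p v)"
  proof (rule Q_left_eqI)
    fix z
    show "Q (coframe A p w) z = Q (\<Gamma> (coframe A p u) (coframe A p v)) z"
      using 2[rule_format, of "left_inv_field A z p"]
        koszul[of "coframe A p u" "coframe A p v" z]
      by (simp add: metric_def)
  qed
  then show ?case by (metis left_inv_field_coframe)
qed

text \<open>The derivative along \<open>e\<^sub>0\<close> of the product \<open>\<Gamma>\<close>, which is constant in the frame, when it is
  viewed in coordinates: the failure of \<open>ad e\<^sub>0\<close> to be a derivation of \<open>\<Gamma>\<close>.\<close>

definition conn_deriv where
  "conn_deriv a b = ad_e0 A (\<Gamma> a b) - \<Gamma> (ad_e0 A a) b - \<Gamma> a (ad_e0 A b)"

lemma frechet_derivative_christoffel: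
  "frechet_derivative (\<lambda>q. christoffel metric q u v) (at p) w =
     left_inv_field A (fst w *\<^sub>R conn_deriv (coframe A p u) (coframe A p v)) p"
proof -
  have "((\<lambda>q. christoffel metric q u v) has_derivative (\<lambda>w.
     left_inv_field A (fst w *\<^sub>R conn_deriv (coframe A p u) (coframe A p v)) p)) (at p)"
    unfolding christoffel_metric conn_deriv_def
    by (rule has_derivative_eq_rhs, rule left_inv_field_has_derivative_compose,
        rule bounded_bilinear.FDERIV[OF bounded_bilinear_conn coframe_has_derivative coframe_has_derivative])
      (simp add: fun_eq_iff algebra_simps scaleR_diff_right bilinear_lmul[OF bilinear_conn] bilinear_rmul[OF bilinear_conn]
       bilinear_lneg[OF bilinear_conn] bilinear_rneg[OF bilinear_conn])
  from frechet_derivative_at[OF this, symmetric] show ?thesis by simp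
qed

definition curv where
  "curv a b = fst a *\<^sub>R conn_deriv b b + \<Gamma> a (\<Gamma> b b) - (fst b *\<^sub>R conn_deriv a b + \<Gamma> b (\<Gamma> a b))"

lemma coframe_curvature:
  "coframe A p (curvature metric p u v v) = curv (coframe A p u) (coframe A p v)"
  unfolding curvature_def frechet_derivative_christoffel
  unfolding christoffel_metric
  by (simp add: curv_def linear_add[OF linear_coframe] linear_diff[OF linear_coframe])

lemma sectional_curvature_metric:
  "sectional_curvature metric p u v =
     (let a = coframe A p u; b = coframe A p v
      in Q (curv a b) a / (Q a a * Q b b - (Q a b)\<^sup>2))"
  by (simp add: sectional_curvature_def metric_def[abs_def] coframe_curvature[unfolded metric_def[abs_def]] Let_def)

end

section \<open>Positive definite bilinear forms\<close>

lemma independent_pair_iff: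
  "x \<noteq> y \<and> independent {x, y} \<longleftrightarrow> (\<forall>\<alpha> \<beta>. \<alpha> *\<^sub>R x + \<beta> *\<^sub>R y = 0 \<longrightarrow> \<alpha> = 0 \<and> \<beta> = 0)"
  (is "?L \<longleftrightarrow> ?R")
proof
  assume L: ?L
  show ?R
  proof (intro allI impI)
    fix \<alpha> \<beta> assume *: "\<alpha> *\<^sub>R x + \<beta> *\<^sub>R y = 0"
    have y: "x \<notin> span {y}" "y \<noteq> 0" using L by (auto simp: independent_insert)
    have "\<alpha> = 0"
    proof (rule ccontr)
      assume "\<alpha> \<noteq> 0"
      have "\<alpha> *\<^sub>R x = (- \<beta>) *\<^sub>R y" using * by (simp add: eq_neg_iff_add_eq_0)
      then have "(1 / \<alpha>) *\<^sub>R (\<alpha> *\<^sub>R x) = (1 / \<alpha>) *\<^sub>R ((- \<beta>) *\<^sub>R y)" by (rule arg_cong)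
      then have "x = (- \<beta> / \<alpha>) *\<^sub>R y" using \<open>\<alpha> \<noteq> 0\<close> by simp
      then show False using y(1) span_scale[OF span_base, of y "{y}" "- \<beta> / \<alpha>"] by simp
    qed
    then show "\<alpha> = 0 \<and> \<beta> = 0" using * y by simp
  qed
next
  assume R: ?R
  have ne: "x \<noteq> y" using R[rule_format, of 1 "-1"] by auto
  have y: "y \<noteq> 0" using R[rule_format, of 0 1] by auto
  have "x \<notin> span {y}"
  proof
    assume "x \<in> span {y}"
    then obtain k where "x = k *\<^sub>R y" by (auto simp: span_singleton)
    then show False using R[rule_format, of 1 "-k"] by simp
  qed
  then show ?L using ne y by (simp add: independent_insert)
qed

text \<open>The Gram--Schmidt step: the square length of \<open>x\<close> made orthogonal to \<open>y\<close> is the Gram determinant, up to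
  the factor \<open>f y y\<close>.  Both forms of the Cauchy--Schwarz inequality are read off from it.\<close>

lemma bilinear_gram_identity:
  assumes "bilinear f" and sym: "\<And>x y. f x y = f y x"
  defines "w \<equiv> \<lambda>x y. f y y *\<^sub>R x - f x y *\<^sub>R y"
  shows "f (w x y) (w x y) = f y y * (f x x * f y y - (f x y)\<^sup>2)"
  using sym[of y x] unfolding w_def
  by (simp add: bilinear_lsub[OF assms(1)] bilinear_rsub[OF assms(1)] bilinear_lmul[OF assms(1)]
      bilinear_rmul[OF assms(1)] algebra_simps power2_eq_square)

lemma bilinear_Cauchy_Schwarz_strict:
  fixes f :: "'a::real_vector \<Rightarrow> 'a \<Rightarrow> real"
  assumes "bilinear f" "\<And>x y. f x y = f y x" and pos: "\<And>x. x \<noteq> 0 \<Longrightarrow> f x x > 0"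
    and "x \<noteq> y \<and> independent {x, y}"
  shows "(f x y)\<^sup>2 < f x x * f y y"
proof -
  note ind = assms(4)[unfolded independent_pair_iff, rule_format]
  have y: "y \<noteq> 0" using ind[of 0 1] by auto
  have "f y y *\<^sub>R x - f x y *\<^sub>R y \<noteq> 0"
    using ind[of "f y y" "- f x y"] pos[OF y] by auto
  then have "0 < f y y * (f x x * f y y - (f x y)\<^sup>2)"
    by (metis pos bilinear_gram_identity[OF assms(1,2)])
  then have "0 < f x x * f y y - (f x y)\<^sup>2"
    using pos[OF y] by (rule zero_less_mult_pos)
  then show ?thesis by simp
qed

lemma bilinear_Cauchy_Schwarz:
  fixes f :: "'a::real_vector \<Rightarrow> 'a \<Rightarrow> real"
  assumes "bilinear f" "\<And>x y. f x y = f y x" and pos: "\<And>x. x \<noteq> 0 \<Longrightarrow> f x x > 0"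
  shows "(f x y)\<^sup>2 \<le> f x x * f y y"
proof (cases "y = 0")
  case False
  have "f z z \<ge> 0" for z
    using pos[of z] bilinear_lzero[OF assms(1), of z] by (cases "z = 0") auto
  then have "0 \<le> f y y * (f x x * f y y - (f x y)\<^sup>2)"
    by (metis bilinear_gram_identity[OF assms(1,2)])
  then have "0 \<le> f x x * f y y - (f x y)\<^sup>2"
    using pos[OF False] by (simp only: zero_le_mult_iff) linarith
  then show ?thesis by simp
qed (simp add: bilinear_rzero[OF assms(1)])

text \<open>A positive definite form embeds the space into its dual, and in finite dimension an injective
  linear map onto a space of the same dimension is surjective.\<close>

lemma Riesz_bilinear:
  fixes Q :: "'a::euclidean_space \<Rightarrow> 'a \<Rightarrow> real"
  assumes Q: "bilinear Q" and pos: "\<And>x. x \<noteq> 0 \<Longrightarrow> Q x x > 0" and f: "linear f"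
  obtains c where "\<And>z. Q c z = f z"
proof -
  let ?F = "\<lambda>c. \<Sum>b\<in>Basis. Q c b *\<^sub>R b"
  have lin: "linear (Q c)" for c using Q by (simp add: bilinear_def)
  have ext: "Q c = g" if "linear g" "\<And>b. b \<in> Basis \<Longrightarrow> Q c b = g b" for c g
    using linear_eq_stdbasis[OF lin that(1)] that(2) by auto
  have F: "linear ?F"
    by (simp add: linear_iff bilinear_ladd[OF Q] bilinear_lmul[OF Q] scaleR_left_distrib sum.distrib
        scaleR_sum_right)
  have "inj ?F"
  proof (subst linear_injective_0[OF F], intro allI impI)
    fix c assume "?F c = 0"
    then have "Q c b = 0" if "b \<in> Basis" for b
      using inner_sum_left_Basis[OF that, of "Q c"] by simp
    from ext[OF linear_zero this] have "Q c = (\<lambda>_. 0)" .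
    then show "c = 0" using pos[of c] by auto
  qed
  from linear_injective_imp_surjective[OF F this]
  have "(\<Sum>b\<in>Basis. f b *\<^sub>R b) \<in> range ?F" by simp
  then obtain c where c: "?F c = (\<Sum>b\<in>Basis. f b *\<^sub>R b)" by (elim rangeE) (rule that, rule sym)
  have "Q c b = f b" if "b \<in> Basis" for b
    using arg_cong[OF c, of "\<lambda>x. x \<bullet> b"]
    unfolding inner_sum_left_Basis[OF that] .
  from ext[OF f this] show ?thesis using that[of c] by simp
qed

section \<open>Negative curvature makes the derivation definite\<close>

text \<open>The Koszul formula prescribes the inner products of \<open>\<Gamma> a b\<close> with all vectors, so representing this
  functional gives \<open>\<Gamma>\<close>; uniqueness of the representing vector makes it bilinear.\<close>

lemma left_inv_metric_exists:
  assumes Q: "bilinear Q" and sym: "\<And>a b. Q a b = Q b a" and pos: "\<And>a. a \<noteq> 0 \<Longrightarrow> Q a a > 0"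
  obtains \<Gamma> where "left_inv_metric A Q \<Gamma>"
proof -
  define k where "k = (\<lambda>a b z. 1/2 * (
        - fst a * (Q (ad_e0 A b) z + Q b (ad_e0 A z))
        - fst b * (Q (ad_e0 A a) z + Q a (ad_e0 A z))
        + fst z * (Q (ad_e0 A a) b + Q a (ad_e0 A b))))"
  note bi = bilinear_ladd[OF Q] bilinear_radd[OF Q] bilinear_lmul[OF Q] bilinear_rmul[OF Q]
    linear_add[OF linear_ad_e0] linear_cmul[OF linear_ad_e0]
  have "\<exists>c. \<forall>z. Q c z = k a b z" for a b
  proof -
    have "linear (k a b)"
      by (simp add: linear_iff k_def bi algebra_simps add_divide_distrib diff_divide_distrib)
    from Riesz_bilinear[OF Q pos this] show ?thesis by metis
  qed
  then obtain \<Gamma> where \<Gamma>: "\<And>a b z. Q (\<Gamma> a b) z = k a b z" by metis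
  have eqI: "a = b" if "\<And>z. Q a z = Q b z" for a b
  proof (rule ccontr)
    assume "a \<noteq> b"
    then have "Q (a - b) (a - b) > 0" by (intro pos) simp
    then show False using that[of "a - b"] by (simp add: bilinear_lsub[OF Q])
  qed
  have b\<Gamma>: "bilinear \<Gamma>"
    unfolding bilinear_def linear_iff
    by (intro conjI allI eqI; simp add: \<Gamma> bi)
      (simp_all add: k_def bi algebra_simps add_divide_distrib diff_divide_distrib)
  have "left_inv_metric A Q \<Gamma>"
    by (unfold_locales; (fact Q sym b\<Gamma> | rule pos, assumption | simp add: \<Gamma> k_def))
  then show ?thesis by (rule that)
qed

context left_inv_metric
begin

text \<open>On the ideal \<open>\<real>\<^sup>n\<close> the product \<open>\<Gamma>\<close> takes values in the line spanned by the normal \<open>N\<close>, so the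
  curvature of a plane in the ideal is given by the Gauss equation: the cosets of the ideal are flat, and what
  remains is minus a Gram determinant of their second fundamental form, which up to a factor is the
  symmetrisation of \<open>Q(ad e\<^sub>0 a, b)\<close>.\<close>

lemma abelian_ideal_curvature:
  obtains \<nu> where "\<nu> > 0"
    "\<And>a b. fst a = 0 \<Longrightarrow> fst b = 0 \<Longrightarrow>
      4 * Q (curv a b) a = - \<nu> * (4 * Q (ad_e0 A a) a * Q (ad_e0 A b) b - (Q (ad_e0 A a) b + Q a (ad_e0 A b))\<^sup>2)"
proof -
  have "linear fst" by (simp add: linear_iff)
  then obtain N where N: "\<And>z. Q N z = fst z"
    using Riesz_bilinear[OF bilinear_Q Q_pos] by metis
  have "N \<noteq> 0" using N[of "(1, 0)"] bilinear_lzero[OF bilinear_Q] by auto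
  then have "fst N > 0" using Q_pos[of N] N[of N] by simp
  moreover have "4 * Q (curv a b) a
      = - fst N * (4 * Q (ad_e0 A a) a * Q (ad_e0 A b) b - (Q (ad_e0 A a) b + Q a (ad_e0 A b))\<^sup>2)"
    if h: "fst a = 0" "fst b = 0" for a b
  proof -
    define \<delta> where "\<delta> = (\<lambda>a b. Q (ad_e0 A a) b + Q a (ad_e0 A b))"
    have G: "\<Gamma> a b = (\<delta> a b / 2) *\<^sub>R N" if "fst a = 0" "fst b = 0" for a b
    proof (rule Q_left_eqI)
      fix z show "Q (\<Gamma> a b) z = Q ((\<delta> a b / 2) *\<^sub>R N) z"
        using koszul[of a b z] that by (simp add: bilinear_lmul[OF bilinear_Q] N \<delta>_def mult.commute)
    qed
    have K: "2 * Q (\<Gamma> a (c *\<^sub>R N)) b = - c * fst N * \<delta> a b" if "fst a = 0" "fst b = 0" for a b c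
      using koszul[of a "c *\<^sub>R N" b] that by (simp add: \<delta>_def algebra_simps)
    have "curv a b = \<Gamma> a ((\<delta> b b / 2) *\<^sub>R N) - \<Gamma> b ((\<delta> a b / 2) *\<^sub>R N)"
      by (simp add: curv_def h G)
    then have "Q (curv a b) a = Q (\<Gamma> a ((\<delta> b b / 2) *\<^sub>R N)) a - Q (\<Gamma> b ((\<delta> a b / 2) *\<^sub>R N)) a"
      by (simp add: bilinear_lsub[OF bilinear_Q])
    moreover have "\<delta> b a = \<delta> a b" using Q_sym by (simp add: \<delta>_def add.commute)
    ultimately have "4 * Q (curv a b) a = - fst N * (\<delta> a a * \<delta> b b - (\<delta> a b)\<^sup>2)"
      using K[OF h(1) h(1), of "\<delta> b b / 2"] K[OF h(2) h(1), of "\<delta> a b / 2"]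
      by (simp add: algebra_simps power2_eq_square)
    also have "\<delta> a a * \<delta> b b = 4 * Q (ad_e0 A a) a * Q (ad_e0 A b) b"
      using Q_sym[of a "ad_e0 A a"] Q_sym[of b "ad_e0 A b"] by (simp add: \<delta>_def)
    finally show ?thesis by (simp add: \<delta>_def)
  qed
  ultimately show ?thesis by (rule that)
qed

lemma negative_curvature_curv:
  assumes "negative_curvature metric" "a \<noteq> b \<and> independent {a, b}"
  shows "Q (curv a b) a < 0"
proof -
  have "(Q a b)\<^sup>2 < Q a a * Q b b"
    by (rule bilinear_Cauchy_Schwarz_strict[OF bilinear_Q Q_sym Q_pos assms(2)])
  moreover have "sectional_curvature metric 0 a b < 0"
    using assms unfolding negative_curvature_def by blast
  ultimately show ?thesis by (simp add: sectional_curvature_metric divide_less_0_iff)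
qed

text \<open>In dimension \<open>n \<ge> 2\<close> the Gram determinants of the quadratic form \<open>q(x) = Q(A x, x)\<close> are all
  positive, so \<open>q\<close> has the same strict sign at any two independent vectors, and two dependent vectors are
  compared through a third one.  In dimension \<open>n = 1\<close> there are no planes in \<open>\<real>\<^sup>n\<close>, but \<open>A\<close> is a
  scalar, and if it vanishes then the metric is flat.\<close>

lemma negative_curvature_imp_definite:
  assumes neg: "negative_curvature metric"
  obtains \<sigma> where "\<And>x. x \<noteq> 0 \<Longrightarrow> \<sigma> * Q (0, A *v x) (0, x) > 0"
proof (cases "CARD('n) = 1")
  case False
  define q where "q = (\<lambda>x. Q (0, A *v x) (0, x))"
  have indep: "q x * q y > 0" if "x \<noteq> y \<and> independent {x, y}" for x y :: "real^'n"
  proof -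
    have "((0::real), x) \<noteq> (0, y) \<and> independent {((0::real), x), (0, y)}"
      using that unfolding independent_pair_iff by (simp add: zero_prod_def)
    from negative_curvature_curv[OF neg this]
    have "Q (curv (0, x) (0, y)) (0, x) < 0" .
    moreover obtain \<nu> where \<nu>: "\<nu> > 0" and "4 * Q (curv (0, x) (0, y)) (0, x)
      = - \<nu> * (4 * q x * q y - (Q (ad_e0 A (0, x)) (0, y) + Q (0, x) (ad_e0 A (0, y)))\<^sup>2)"
      using abelian_ideal_curvature by (metis (no_types, lifting) q_def ad_e0_def fst_conv snd_conv)
    ultimately have "0 < \<nu> * (4 * q x * q y - (Q (ad_e0 A (0, x)) (0, y) + Q (0, x) (ad_e0 A (0, y)))\<^sup>2)"
      by simp
    from zero_less_mult_pos[OF this \<nu>] have "(Q (ad_e0 A (0, x)) (0, y) + Q (0, x) (ad_e0 A (0, y)))\<^sup>2 < 4 * (q x * q y)"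
      by simp
    then have "0 < 4 * (q x * q y)" by (rule le_less_trans[OF zero_le_power2])
    then show ?thesis by simp
  qed
  have ex: "\<exists>z. z \<notin> span {x}" for x :: "real^'n"
  proof (rule ccontr)
    assume "\<nexists>z. z \<notin> span {x}"
    then have "span {x} = (UNIV :: (real^'n) set)" by blast
    then have "dim (UNIV :: (real^'n) set) \<le> card {x}" by (metis dim_le_card' dim_span finite.emptyI finite_insert)
    then have "CARD('n) \<le> 1" by (simp add: dim_UNIV)
    moreover have "CARD('n) > 0" by simp
    ultimately show False using False by linarith
  qed
  have notin: "x \<noteq> y \<and> independent {x, y}" if "x \<notin> span {y}" "y \<noteq> 0" for x y :: "real^'n"
    using that span_base[of x "{x}"] by (auto simp: independent_insert)
  have "q x * q y > 0" if "x \<noteq> 0" "y \<noteq> 0" for x y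
  proof (cases "y \<in> span {x}")
    case True
    then obtain c where c: "y = c *\<^sub>R x" by (auto simp: span_singleton)
    obtain z where z: "z \<notin> span {x}" using ex by blast
    have "z \<notin> span {y}"
    proof
      assume "z \<in> span {y}"
      then obtain d where "z = d *\<^sub>R y" by (auto simp: span_singleton)
      then show False using z c by (metis scaleR_scaleR span_base span_scale singletonI)
    qed
    then have "q z * q x > 0" "q z * q y > 0"
      using indep notin z that by blast+
    then show ?thesis by (auto simp: zero_less_mult_iff)
  next
    case False
    then have "q y * q x > 0" using indep notin that by blast
    then show ?thesis by (simp add: mult.commute)
  qed
  moreover have "(1 :: real^'n) \<noteq> 0" by simp
  ultimately show ?thesis using that[of "q 1"] unfolding q_def by blast
next
  case True
  then obtain i :: 'n where i: "UNIV = {i}" using card_1_singletonE by blast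
  then have j: "j = i" for j by (metis UNIV_I singletonD)
  define a where "a = A $ i $ i"
  have A: "A *v x = a *\<^sub>R x" for x
  proof (unfold vec_eq_iff, rule allI)
    fix k show "(A *v x) $ k = (a *\<^sub>R x) $ k"
      unfolding j[of k] by (simp add: matrix_vector_mult_def i a_def)
  qed
  have "a \<noteq> 0"
  proof
    assume "a = 0"
    then have [simp]: "ad_e0 A x = 0" for x by (simp add: ad_e0_def A zero_prod_def)
    have [simp]: "\<Gamma> x y = 0" for x y
    proof (rule Q_left_eqI)
      fix z show "Q (\<Gamma> x y) z = Q 0 z"
        using koszul[of x y z] by (simp add: bilinear_lzero[OF bilinear_Q] bilinear_rzero[OF bilinear_Q])
    qed
    have "curv x y = 0" for x y
      by (simp add: curv_def conn_deriv_def)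
    moreover have "(1::real, 0) \<noteq> (0, 1 :: real^'n) \<and> independent {(1::real, 0), (0, 1 :: real^'n)}"
      unfolding independent_pair_iff by (simp add: zero_prod_def)
    ultimately show False using negative_curvature_curv[OF neg]
      by (metis bilinear_lzero[OF bilinear_Q] less_irrefl)
  qed
  have "a * Q (0, A *v x) (0, x) > 0" if "x \<noteq> 0" for x
  proof -
    have "Q (0, A *v x) (0, x) = a * Q (0, x) (0, x)"
      using bilinear_lmul[OF bilinear_Q, of a "(0, x)"] by (simp add: A)
    moreover have "Q (0, x) (0, x) > 0" using that by (intro Q_pos) (simp add: zero_prod_def)
    moreover have "a * a > 0" using \<open>a \<noteq> 0\<close> by (auto simp: zero_less_mult_iff)
    ultimately show ?thesis by (simp flip: mult.assoc)
  qed
  then show ?thesis by (rule that)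
qed

end

text \<open>Half of Heintze's characterisation of negatively curved homogeneous spaces, in the form of a
  Lyapunov function: \<open>\<sigma> A\<close> is positive for a suitable inner product, so that the eigenvalues of \<open>A\<close>
  lie strictly on one side of the imaginary axis.\<close>

theorem Heintze_necessary:
  fixes A :: "real^'n^'n"
  assumes "riemannian_metric g" "left_invariant A g" "negative_curvature g"
  obtains P :: "real^'n \<Rightarrow> real^'n \<Rightarrow> real" and \<sigma> :: real where "bilinear P" "\<And>x y. P x y = P y x" "\<And>x. x \<noteq> 0 \<Longrightarrow> P x x > 0"
    "\<And>x. x \<noteq> 0 \<Longrightarrow> \<sigma> * P (A *v x) x > 0"
proof -
  note g0 = assms(1)[unfolded riemannian_metric_def, THEN conjunct1, THEN spec, of 0]
  have Q: "bilinear (g 0)" "\<And>a b. g 0 a b = g 0 b a" "\<And>a. a \<noteq> 0 \<Longrightarrow> g 0 a a > 0"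
    by (rule g0[THEN conjunct1], rule g0[THEN conjunct2, THEN conjunct1, rule_format],
        rule g0[THEN conjunct2, THEN conjunct2, rule_format])
  obtain \<Gamma> where "left_inv_metric A (g 0) \<Gamma>"
    using left_inv_metric_exists[OF Q] by metis
  then interpret left_inv_metric A "g 0" \<Gamma> .
  have [simp]: "fst (ginv A p) = - fst p" for p :: "real \<times> (real^'n)" by (simp add: ginv_def)
  have "g p u v = metric p u v" for p u v
    using assms(2)[unfolded left_invariant_def, rule_format, of "ginv A p" p u v]
    by (simp add: metric_def coframe_def frechet_derivative_gmult gmult_ginv_left)
  then have "g = metric" by (simp add: fun_eq_iff)
  with assms(3) have "negative_curvature metric" by simp
  then have "\<exists>\<sigma>. \<forall>x. x \<noteq> 0 \<longrightarrow> \<sigma> * g 0 (0, A *v x) (0, x) > 0"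
  proof (rule negative_curvature_imp_definite)
    fix \<sigma> assume "\<And>x. x \<noteq> 0 \<Longrightarrow> \<sigma> * g 0 (0, A *v x) (0, x) > 0"
    then show ?thesis by (intro exI[of _ \<sigma>] allI impI)
  qed
  then obtain \<sigma> where \<sigma>: "\<forall>x. x \<noteq> 0 \<longrightarrow> \<sigma> * g 0 (0, A *v x) (0, x) > 0" by (rule exE)
  show ?thesis
  proof (rule that[of "\<lambda>x y. g 0 (0, x) (0, y)" \<sigma>])
    show "bilinear (\<lambda>x y. g 0 (0, x) (0, y))"
      using bilinear_ladd[OF Q(1), of "(0, _)" "(0, _)"] bilinear_radd[OF Q(1), of _ "(0, _)" "(0, _)"]
        bilinear_lmul[OF Q(1), of _ "(0, _)"] bilinear_rmul[OF Q(1), of _ _ "(0, _)"]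
      by (simp add: bilinear_def linear_iff)
  qed (use Q \<sigma> in \<open>simp_all add: zero_prod_def\<close>)
qed


section \<open>The curvature of the standard metric\<close>

lemma transpose_inner:
  fixes A :: "real^'n^'m"
  shows "(transpose A *v x) \<bullet> y = x \<bullet> (A *v y)"
  unfolding transpose_matrix_vector by (rule dot_lmul_matrix)

lemma inner_sym_part: "2 * ((sym_part A *v x) \<bullet> y) = (A *v x) \<bullet> y + x \<bullet> (A *v y)"
proof -
  have "2 *\<^sub>R sym_part A = A + transpose A"
    by (simp add: sym_part_def)
  then have "2 *\<^sub>R (sym_part A *v x) = A *v x + transpose A *v x"
    by (metis scaleR_matrix_vector_assoc matrix_vector_mult_add_rdistrib)
  then have "(2 *\<^sub>R (sym_part A *v x)) \<bullet> y = (A *v x) \<bullet> y + (transpose A *v x) \<bullet> y"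
    by (simp only: inner_add_left)
  then show ?thesis by (simp only: transpose_inner inner_scaleR_left)
qed

lemma sym_part_inner_commute: "(sym_part A *v x) \<bullet> y = x \<bullet> (sym_part A *v y)"
  using inner_sym_part[of A x y] inner_sym_part[of A y x]
  by (simp add: inner_commute)

text \<open>The product \<open>\<Gamma>\<close> for the standard inner product: the symmetric part of \<open>A\<close> is the second fundamental
  form of the ideal.\<close>

definition gconn :: "real^'n^'n \<Rightarrow> real \<times> (real^'n) \<Rightarrow> real \<times> (real^'n) \<Rightarrow> real \<times> (real^'n)" where
  "gconn A a b = ((sym_part A *v snd a) \<bullet> snd b,
     - (fst a *\<^sub>R (sym_part A *v snd b)) - fst b *\<^sub>R (sym_part A *v snd a))"

lemma left_inv_metric_gconn:
  fixes A :: "real^'n^'n"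
  shows "left_inv_metric A (\<bullet>) (gconn A)"
proof
  show "bilinear ((\<bullet>) :: real \<times> (real^'n) \<Rightarrow> _)"
    by (simp add: bilinear_def linear_iff inner_add_left inner_add_right)
  show "bilinear (gconn A)"
    by (simp add: bilinear_def linear_iff gconn_def matrix_vector_right_distrib
        matrix_vector_mult_scaleR inner_add_left inner_add_right algebra_simps)
  show "2 * (gconn A a b \<bullet> z) =
        - fst a * (ad_e0 A b \<bullet> z + b \<bullet> ad_e0 A z)
        - fst b * (ad_e0 A a \<bullet> z + a \<bullet> ad_e0 A z)
        + fst z * (ad_e0 A a \<bullet> b + a \<bullet> ad_e0 A b)" for a b z :: "real \<times> (real^'n)"
    using arg_cong[OF inner_sym_part[of A "snd a" "snd b"], of "\<lambda>r. fst z * r"]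
      arg_cong[OF inner_sym_part[of A "snd a" "snd z"], of "\<lambda>r. fst b * r"]
      arg_cong[OF inner_sym_part[of A "snd b" "snd z"], of "\<lambda>r. fst a * r"]
    by (simp add: gconn_def ad_e0_def inner_prod_def inner_diff_left algebra_simps)
qed (auto simp: inner_commute)

text \<open>The two summands belong to planes through \<open>e\<^sub>0\<close> and to planes in the ideal; no mixed term
  survives, because \<open>R(x,y)e\<^sub>0 = 0\<close> for \<open>x\<close> and \<open>y\<close> in the ideal.  Writing \<open>A = S + T\<close> with \<open>T\<close> skew,
  \<open>q z\<close> is \<open>|S z|\<^sup>2 + 2\<langle>S z, T z\<rangle>\<close>.\<close>

lemma gmetric_curvature:
  fixes A :: "real^'n^'n" and x y :: "real^'n"
  defines "S \<equiv> \<lambda>z. sym_part A *v z"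
  defines "q \<equiv> \<lambda>z. 2 * (S z \<bullet> (A *v z)) - S z \<bullet> S z"
  shows "left_inv_metric.curv A (gconn A) (r, x) (s, y) \<bullet> (r, x) =
     - q (r *\<^sub>R y - s *\<^sub>R x) - ((S x \<bullet> x) * (S y \<bullet> y) - (S x \<bullet> y)\<^sup>2)"
proof -
  interpret left_inv_metric A "(\<bullet>)" "gconn A" by (rule left_inv_metric_gconn)
  note lin = matrix_vector_right_distrib matrix_vector_mult_scaleR matrix_vector_mult_diff_distrib
    linear_neg[OF matrix_vector_mul_linear]
  have c: "S z \<bullet> w = z \<bullet> S w" for z w
    unfolding S_def by (rule sym_part_inner_commute)
  have A: "(A *v w) \<bullet> z = 2 * (S w \<bullet> z) - w \<bullet> (A *v z)" for w z
    using inner_sym_part[of A w z] by (simp add: S_def)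
  have l: "S (z + w) = S z + S w" "S (z - w) = S z - S w" "S (t *\<^sub>R z) = t *\<^sub>R S z" "S (- z) = - S z"  "S 0 = 0" for z w t
    by (simp_all add: S_def lin)
  have g: "gconn A a b = (S (snd a) \<bullet> snd b, - (fst a *\<^sub>R S (snd b)) - fst b *\<^sub>R S (snd a))" for a b
    by (simp add: gconn_def S_def)
  have 1: "(A *v S y) \<bullet> x = 2 * (S x \<bullet> S y) - S y \<bullet> (A *v x)"
     "(A *v S x) \<bullet> x = 2 * (S x \<bullet> S x) - S x \<bullet> (A *v x)"
     "(A *v S y) \<bullet> y = 2 * (S y \<bullet> S y) - S y \<bullet> (A *v y)"
    using A[of "S y" x] A[of "S x" x] A[of "S y" y] c[of "S y" x] c[of "S x" x] c[of "S y" y]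
    by (simp_all add: inner_commute)
  have 2: "S (A *v y) \<bullet> x = S x \<bullet> (A *v y)" "S (A *v x) \<bullet> x = S x \<bullet> (A *v x)"
     "S (A *v y) \<bullet> y = S y \<bullet> (A *v y)" "S (A *v x) \<bullet> y = S y \<bullet> (A *v x)"
     "S (S y) \<bullet> x = S x \<bullet> S y" "S (S x) \<bullet> x = S x \<bullet> S x" 
     "S y \<bullet> x = S x \<bullet> y" "S y \<bullet> S x = S x \<bullet> S y"
     "x \<bullet> (S z) = S x \<bullet> z" "y \<bullet> (S z) = S y \<bullet> z" for z
    by (metis c inner_commute)+
  \<comment> \<open>Simplification collects \<open>v + v\<close> into the componentwise product with \<open>2\<close>; this makes it a scalar multiple again.\<close>
  have 3: "z * 2 = 2 *\<^sub>R z" "2 * z = 2 *\<^sub>R z" for z :: "real^'n"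
    by (simp_all add: vec_eq_iff)
  show ?thesis
    unfolding curv_def conn_deriv_def g ad_e0_def q_def
    by (simp add: l lin inner_add_left inner_diff_left inner_add_right inner_diff_right 1 2 3
        algebra_simps power2_eq_square)
qed

text \<open>Both terms of \<open>gmetric_curvature\<close> are then nonpositive, and they do not vanish together: if the
  vector \<open>r y - s x\<close> is zero for independent \<open>(r, x)\<close> and \<open>(s, y)\<close>, then \<open>r = s = 0\<close> and \<open>x\<close>, \<open>y\<close> are
  independent, so that the Gram determinant is strictly positive.  The factor \<open>\<sigma>\<close> covers both signs
  of a definite \<open>S\<close>.\<close>

theorem negative_curvature_gmetricI:
  fixes A :: "real^'n^'n" and \<sigma> :: real
  defines "S \<equiv> \<lambda>z. sym_part A *v z"
  assumes def: "\<And>z. z \<noteq> 0 \<Longrightarrow> \<sigma> * (S z \<bullet> z) > 0"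
    and rad: "\<And>z. z \<noteq> 0 \<Longrightarrow> S z \<bullet> S z < 2 * (S z \<bullet> (A *v z))"
  shows "negative_curvature (gmetric A)"
proof -
  interpret left_inv_metric A "(\<bullet>)" "gconn A" by (rule left_inv_metric_gconn)
  have m: "gmetric A = metric"
    by (simp add: fun_eq_iff metric_def gmetric_def coframe_def frechet_derivative_gmult ginv_def)
  define f where "f = (\<lambda>x y. \<sigma> * (S x \<bullet> y))"
  have "1 \<noteq> (0 :: real^'n)" by simp
  from def[OF this] have \<sigma>: "\<sigma>\<^sup>2 > 0" by auto
  have f: "bilinear f" "f x y = f y x" for x y
    using sym_part_inner_commute[of A x y]
    by (simp_all add: bilinear_def linear_iff f_def S_def matrix_vector_right_distrib inner_commute
        matrix_vector_mult_scaleR inner_add_left inner_add_right algebra_simps)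
  have gram: "f x x * f y y - (f x y)\<^sup>2 = \<sigma>\<^sup>2 * ((S x \<bullet> x) * (S y \<bullet> y) - (S x \<bullet> y)\<^sup>2)" for x y
    by (simp add: f_def algebra_simps power2_eq_square)
  have pos: "f x x > 0" if "x \<noteq> 0" for x
    using def[OF that] by (simp add: f_def)
  have neg: "curv a b \<bullet> a < 0" if ind: "a \<noteq> b \<and> independent {a, b}" for a b
  proof -
    obtain r x s y where ab: "a = (r, x)" "b = (s, y)" by (metis surj_pair)
    define z where "z = r *\<^sub>R y - s *\<^sub>R x"
    have c: "curv a b \<bullet> a = (S z \<bullet> S z - 2 * (S z \<bullet> (A *v z))) - ((S x \<bullet> x) * (S y \<bullet> y) - (S x \<bullet> y)\<^sup>2)"
      unfolding ab gmetric_curvature S_def z_def by simp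
    have "0 \<le> \<sigma>\<^sup>2 * ((S x \<bullet> x) * (S y \<bullet> y) - (S x \<bullet> y)\<^sup>2)"
      using bilinear_Cauchy_Schwarz[OF f pos, of x y] unfolding gram[symmetric] by simp
    then have g: "0 \<le> (S x \<bullet> x) * (S y \<bullet> y) - (S x \<bullet> y)\<^sup>2"
      using \<sigma> by (simp add: zero_le_mult_iff)
    show ?thesis
    proof (cases "z = 0")
      case False
      with g rad[OF this] show ?thesis unfolding c by linarith
    next
      case True
      note i = ind[unfolded independent_pair_iff ab, rule_format]
      have "r = 0 \<and> s = 0"
        using i[of "- s" r] True by (simp add: z_def zero_prod_def)
      then have "\<forall>\<alpha> \<beta>. \<alpha> *\<^sub>R x + \<beta> *\<^sub>R y = 0 \<longrightarrow> \<alpha> = 0 \<and> \<beta> = 0"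
        by (intro allI impI i) (simp add: zero_prod_def)
      then have "x \<noteq> y \<and> independent {x, y}"
        by (simp only: independent_pair_iff)
      from bilinear_Cauchy_Schwarz_strict[OF f pos this]
      have "0 < \<sigma>\<^sup>2 * ((S x \<bullet> x) * (S y \<bullet> y) - (S x \<bullet> y)\<^sup>2)"
        unfolding gram[symmetric] by simp
      from zero_less_mult_pos[OF this \<sigma>] True show ?thesis
        unfolding c by (simp add: S_def)
    qed
  qed
  show ?thesis
    unfolding m negative_curvature_def sectional_curvature_metric Let_def
  proof (intro allI impI)
    fix p u v :: "real \<times> (real^'n)"
    assume uv: "u \<noteq> v \<and> independent {u, v}"
    define a b where ab: "a = coframe A p u" "b = coframe A p v"
    have uv0: "\<alpha> *\<^sub>R u + \<beta> *\<^sub>R v = 0" if "\<alpha> *\<^sub>R a + \<beta> *\<^sub>R b = 0" for \<alpha> \<beta>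
    proof -
      have "coframe A p (\<alpha> *\<^sub>R u + \<beta> *\<^sub>R v) = 0"
        using that by (simp add: ab linear_add[OF linear_coframe] linear_cmul[OF linear_coframe])
      then have "left_inv_field A 0 p = \<alpha> *\<^sub>R u + \<beta> *\<^sub>R v"
        using left_inv_field_coframe[of A p "\<alpha> *\<^sub>R u + \<beta> *\<^sub>R v"] by simp
      then show ?thesis by (simp add: left_inv_field_eq zero_prod_def)
    qed
    have ab_ind: "a \<noteq> b \<and> independent {a, b}"
      unfolding independent_pair_iff
      by (intro allI impI uv[unfolded independent_pair_iff, rule_format] uv0)
    from neg[OF ab_ind] bilinear_Cauchy_Schwarz_strict[OF bilinear_Q Q_sym Q_pos ab_ind]
    show "curv (coframe A p u) (coframe A p v) \<bullet> coframe A p u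
        / ((coframe A p u \<bullet> coframe A p u) * (coframe A p v \<bullet> coframe A p v) - (coframe A p u \<bullet> coframe A p v)\<^sup>2) < 0"
      by (simp add: ab divide_less_0_iff)
  qed
qed

section \<open>The Frobenius inner product and the commutator of a matrix with its transpose\<close>

lemma matrix_inner_mult_left:
  fixes X :: "real^'m^'n" and Y :: "real^'k^'m"
  shows "(X ** Y) \<bullet> Z = Y \<bullet> (transpose X ** Z)"
proof -
  have "(X ** Y) \<bullet> Z = (\<Sum>i\<in>UNIV. \<Sum>j\<in>UNIV. \<Sum>k\<in>UNIV. X $ i $ k * Y $ k $ j * Z $ i $ j)"
    by (simp add: inner_vec_def matrix_matrix_mult_def sum_distrib_right)
  also have "\<dots> = (\<Sum>i\<in>UNIV. \<Sum>k\<in>UNIV. \<Sum>j\<in>UNIV. X $ i $ k * Y $ k $ j * Z $ i $ j)"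
    by (intro sum.cong refl sum.swap)
  also have "\<dots> = (\<Sum>k\<in>UNIV. \<Sum>i\<in>UNIV. \<Sum>j\<in>UNIV. X $ i $ k * Y $ k $ j * Z $ i $ j)"
    by (rule sum.swap)
  also have "\<dots> = (\<Sum>k\<in>UNIV. \<Sum>j\<in>UNIV. \<Sum>i\<in>UNIV. X $ i $ k * Y $ k $ j * Z $ i $ j)"
    by (intro sum.cong refl sum.swap)
  also have "\<dots> = Y \<bullet> (transpose X ** Z)"
    by (simp add: inner_vec_def matrix_matrix_mult_def transpose_def sum_distrib_left mult_ac)
  finally show ?thesis .
qed

lemma inner_transpose_transpose:
  fixes X Y :: "real^'m^'n"
  shows "transpose X \<bullet> transpose Y = X \<bullet> Y"
  by (simp add: inner_vec_def transpose_def) (rule sum.swap)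

lemma matrix_inner_mult_right:
  fixes X :: "real^'m^'n" and Y :: "real^'k^'m"
  shows "(X ** Y) \<bullet> Z = X \<bullet> (Z ** transpose Y)"
  using matrix_inner_mult_left[of "transpose Y" "transpose X" "transpose Z"]
  by (simp only: inner_transpose_transpose matrix_transpose_mul[symmetric] transpose_transpose)
    (metis inner_transpose_transpose matrix_transpose_mul transpose_transpose)

lemma transpose_diff: "transpose (X - Y) = transpose X - transpose (Y :: real^'m^'n)"
  by (simp add: transpose_def vec_eq_iff)

lemma transpose_add: "transpose (X + Y) = transpose X + transpose (Y :: real^'m^'n)"
  by (simp add: transpose_def vec_eq_iff)

lemma transpose_scaleR: "transpose (c *\<^sub>R Y) = c *\<^sub>R transpose (Y :: real^'m^'n)"
  by (simp add: transpose_def vec_eq_iff)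

lemma norm_transpose: "norm (transpose X) = norm (X :: real^'m^'n)"
  by (simp add: norm_eq_sqrt_inner inner_transpose_transpose)

lemma bounded_linear_transpose: "bounded_linear (transpose :: real^'m^'n \<Rightarrow> real^'n^'m)"
  by (rule bounded_linear_intro[where K = 1]) (simp_all add: transpose_add transpose_scaleR norm_transpose)

lemma bounded_bilinear_commutator: "bounded_bilinear (commutator :: real^'n^'n \<Rightarrow> _)"
proof -
  have "bounded_bilinear (\<lambda>A B :: real^'n^'n. B ** A)"
    by (rule bounded_bilinear.flip[OF bounded_bilinear_matrix_mult])
  then show ?thesis
    unfolding commutator_def [abs_def]
    using bounded_bilinear_matrix_mult[where 'n = 'n and 'm = 'n and 'k = 'n]
    by (simp add: bilinear_conv_bounded_bilinear[symmetric] bilinear_def linear_iff algebra_simps)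
qed

text \<open>Up to a factor, this is the moment map of the conjugation action of the general linear group on
  matrices.  It vanishes exactly on the normal matrices.\<close>

abbreviation moment :: "real^'n^'n \<Rightarrow> real^'n^'n" where
  "moment B \<equiv> commutator B (transpose B)"

lemma transpose_commutator: "transpose (commutator X Y) = commutator (transpose Y) (transpose X)"
  by (simp add: commutator_def transpose_diff matrix_transpose_mul)

lemma transpose_moment: "transpose (moment B) = moment B"
  by (simp add: transpose_commutator)

lemma moment_scaleR: "moment (c *\<^sub>R B) = c\<^sup>2 *\<^sub>R moment B"
  by (simp add: transpose_scaleR power2_eq_square
      bounded_bilinear.scaleR_left[OF bounded_bilinear_commutator] bounded_bilinear.scaleR_right[OF bounded_bilinear_commutator])

text \<open>The next four identities say that \<open>[B, [B, B\<^sup>t]]\<close> is, up to a factor, the negative gradient of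
  \<open>|[B, B\<^sup>t]|\<^sup>2\<close> and decreases \<open>|B|\<close>, and that the direction \<open>[B, B\<^sup>t]\<close>, being tangent to the orbit of the orthogonal group,
  changes neither \<open>|B|\<close> nor \<open>|[B, B\<^sup>t]|\<close>.  They all follow by moving factors across the inner product.\<close>

lemma inner_commutator_moment: "B \<bullet> commutator B (moment B) = - (moment B \<bullet> moment B)"
proof -
  have "(B ** M) \<bullet> B = M \<bullet> (transpose B ** B)" "(M ** B) \<bullet> B = M \<bullet> (B ** transpose B)" for M
    by (rule matrix_inner_mult_left, rule matrix_inner_mult_right)
  then have "commutator B M \<bullet> B = - (M \<bullet> commutator B (transpose B))" for M
    by (simp add: commutator_def inner_diff_left inner_diff_right)
  then show ?thesis by (simp add: inner_commute)
qed

lemma inner_moment: "B \<bullet> moment B = 0"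
proof -
  have "(B ** transpose B) \<bullet> B = B \<bullet> (B ** B)"
    using matrix_inner_mult_right[of B "transpose B" B] by simp
  moreover have "(transpose B ** B) \<bullet> B = B \<bullet> (B ** B)"
    using matrix_inner_mult_left[of "transpose B" B B] by simp
  ultimately show ?thesis
    by (simp add: commutator_def inner_diff_right inner_commute)
qed

lemma commutator_moment_inner_moment: "commutator B (moment B) \<bullet> moment B = 0"
proof -
  let ?N = "moment B"
  have "(B ** ?N) \<bullet> ?N = B \<bullet> (?N ** ?N)"
    using matrix_inner_mult_right[of B ?N ?N] by (simp add: transpose_moment)
  moreover have "(?N ** B) \<bullet> ?N = B \<bullet> (?N ** ?N)"
    using matrix_inner_mult_left[of ?N B ?N] by (simp add: transpose_moment)
  ultimately show ?thesis
    unfolding commutator_def[of B ?N] by (simp add: inner_diff_left)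
qed

lemma moment_inner_derivative:
  "moment B \<bullet> (commutator H (transpose B) + commutator B (transpose H))
     = - 2 * (commutator B (moment B) \<bullet> H)"
proof -
  let ?N = "moment B"
  have "?N \<bullet> commutator B (transpose H) = transpose ?N \<bullet> transpose (commutator B (transpose H))"
    by (rule inner_transpose_transpose[symmetric])
  also have "\<dots> = ?N \<bullet> commutator H (transpose B)"
    by (simp only: transpose_moment transpose_commutator transpose_transpose)
  finally have 1: "?N \<bullet> commutator B (transpose H) = ?N \<bullet> commutator H (transpose B)" .
  have "(H ** transpose B) \<bullet> ?N = H \<bullet> (?N ** B)"
    using matrix_inner_mult_right[of H "transpose B" ?N] by simp
  moreover have "(transpose B ** H) \<bullet> ?N = H \<bullet> (B ** ?N)"
    using matrix_inner_mult_left[of "transpose B" H ?N] by simp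
  ultimately have "commutator H (transpose B) \<bullet> ?N = - (commutator B ?N \<bullet> H)"
    unfolding commutator_def[of H] commutator_def[of B ?N]
    by (simp add: inner_diff_left inner_diff_right inner_commute)
  with 1 show ?thesis by (simp add: inner_add_right inner_commute)
qed

lemma trace_sym_part_square: "trace (sym_part B ** sym_part B) = (norm (sym_part B))\<^sup>2"
proof -
  have s: "sym_part B $ i $ j = sym_part B $ j $ i" for i j
    by (simp add: sym_part_def transpose_def)
  have "trace (sym_part B ** sym_part B) = sym_part B \<bullet> sym_part B"
    using s by (simp add: trace_def matrix_matrix_mult_def inner_vec_def) 
  then show ?thesis by (simp add: power2_norm_eq_inner)
qed

lemma norm_sym_part_le: "norm (sym_part B) \<le> norm B"
proof -
  have "norm (sym_part B) = norm (B + transpose B) / 2"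
    by (simp add: sym_part_def)
  also have "\<dots> \<le> norm B"
    using norm_triangle_ineq[of B "transpose B"] by (simp add: norm_transpose)
  finally show ?thesis .
qed

lemma sym_part_scaleR: "sym_part (c *\<^sub>R B) = c *\<^sub>R sym_part B"
  by (simp add: sym_part_def transpose_scaleR scaleR_add_right)

section \<open>The determinant along a Lax equation\<close>

lemma det_differentiable: "(det :: real^'n^'n \<Rightarrow> real) differentiable (at X)"
proof -
  have c: "((\<lambda>X :: real^'n^'n. X $ i $ j) has_derivative (\<lambda>H. H $ i $ j)) (at X)" for i j
    by (intro bounded_linear_imp_has_derivative bounded_linear_compose[OF bounded_linear_vec_nth bounded_linear_vec_nth])
  have *: "((\<lambda>X :: real^'n^'n. \<Sum>p\<in>P. s p * (\<Prod>i\<in>UNIV. X $ i $ p i)) has_derivative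
      (\<lambda>H. \<Sum>p\<in>P. s p * (\<Sum>i\<in>UNIV. H $ i $ p i * (\<Prod>j\<in>UNIV - {i}. X $ j $ p j)))) (at X)"
    for P and s :: "('n \<Rightarrow> 'n) \<Rightarrow> real"
    by (intro has_derivative_sum has_derivative_mult_right has_derivative_prod c)
  show ?thesis
    unfolding differentiable_def det_def [abs_def] by (rule exI, rule *)
qed

lemma det_derivative_chain:
  assumes D: "(det has_derivative D) (at (M t))" and M: "(M has_vector_derivative M') (at t)"
  shows "((\<lambda>t. det (M t)) has_real_derivative D M') (at t)"
proof -
  have "((\<lambda>t. det (M t)) has_derivative (\<lambda>h. D (h *\<^sub>R M'))) (at t)"
    using diff_chain_at[OF M[unfolded has_vector_derivative_def] D] by (simp add: o_def)
  moreover have "D (h *\<^sub>R M') = D M' * h" for h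
    using has_derivative_linear[OF D] by (simp add: linear_cmul)
  ultimately show ?thesis by (simp add: has_field_derivative_def)
qed

text \<open>The direction \<open>[M, V]\<close> is the velocity at \<open>h = 0\<close> of \<open>(1 - h V) M (1 + h V)\<close>, whose determinant is
  \<open>det M\<close> times \<open>det (1 - h\<^sup>2 V\<^sup>2)\<close> and hence is constant to first order.\<close>

lemma det_conj_derivative:
  fixes M :: "real \<Rightarrow> real^'n^'n"
  assumes M: "(M has_vector_derivative commutator (M t) V) (at t)"
  shows "((\<lambda>t. det (M t)) has_real_derivative 0) (at t)"
proof -
  obtain D where D: "(det has_derivative D) (at (M t))"
    using det_differentiable unfolding differentiable_def by blast
  obtain D1 where D1: "(det has_derivative D1) (at (mat 1 :: real^'n^'n))"
    using det_differentiable unfolding differentiable_def by blast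
  note mm = bounded_bilinear.has_vector_derivative[OF bounded_bilinear_matrix_mult]
  define \<gamma> where "\<gamma> = (\<lambda>h. ((mat 1 - h *\<^sub>R V) ** M t) ** (mat 1 + h *\<^sub>R V))"
  have "((\<lambda>h. mat 1 - h *\<^sub>R V) has_vector_derivative - V) (at 0)"
    "((\<lambda>h. mat 1 + h *\<^sub>R V) has_vector_derivative V) (at 0)"
    "((\<lambda>h. M t) has_vector_derivative 0) (at 0)"
    by (auto intro!: derivative_eq_intros)
  from mm[OF mm[OF this(1,3)] this(2)]
  have "(\<gamma> has_vector_derivative commutator (M t) V) (at 0)"
    by (simp add: \<gamma>_def commutator_def bounded_bilinear.minus_left[OF bounded_bilinear_matrix_mult]
      bounded_bilinear.zero_right[OF bounded_bilinear_matrix_mult])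
  moreover have "\<gamma> 0 = M t" by (simp add: \<gamma>_def)
  ultimately have 1: "((\<lambda>h. det (\<gamma> h)) has_real_derivative D (commutator (M t) V)) (at 0)"
    using D by (intro det_derivative_chain) auto
  define \<delta> where "\<delta> = (\<lambda>h. mat 1 - (h\<^sup>2) *\<^sub>R (V ** V))"
  have d: "(mat 1 - h *\<^sub>R V) ** (mat 1 + h *\<^sub>R V) = \<delta> h" for h
    by (simp add: \<delta>_def bounded_bilinear.diff_left[OF bounded_bilinear_matrix_mult]
      bounded_bilinear.add_right[OF bounded_bilinear_matrix_mult]
      bounded_bilinear.scaleR_left[OF bounded_bilinear_matrix_mult]
      bounded_bilinear.scaleR_right[OF bounded_bilinear_matrix_mult] power2_eq_square
      scaleR_right_diff_distrib)
  have g: "det (\<gamma> h) = det (M t) * det (\<delta> h)" for h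
    unfolding d[symmetric] by (simp add: \<gamma>_def det_mul)
  have "(\<delta> has_vector_derivative 0) (at 0)"
    unfolding \<delta>_def by (auto intro!: derivative_eq_intros)
  moreover have "\<delta> 0 = mat 1" by (simp add: \<delta>_def)
  ultimately have "((\<lambda>h. det (\<delta> h)) has_real_derivative D1 0) (at 0)"
    using D1 by (intro det_derivative_chain) auto
  moreover have "D1 0 = 0" using has_derivative_linear[OF D1] by (rule linear_0)
  ultimately have "((\<lambda>h. det (\<gamma> h)) has_real_derivative 0) (at 0)"
    unfolding g by (auto intro!: derivative_eq_intros)
  with 1 have "D (commutator (M t) V) = 0" by (rule DERIV_unique)
  with det_derivative_chain[of D M, OF D M] show ?thesis by simp
qed

section \<open>The bracket flow up to scaling\<close>

text \<open>The part of the bracket flow that remains after the scaling term has been absorbed.\<close>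

definition moment_flow_field :: "real^'n^'n \<Rightarrow> real^'n^'n" where
  "moment_flow_field B = (1/2) *\<^sub>R commutator B (moment B) - (trace B / 2) *\<^sub>R moment B"

lemma bracket_flow_field_scaleR:
  fixes B :: "real^'n^'n"
  shows "bracket_flow_field (c *\<^sub>R B)
    = (- (c * (norm (c *\<^sub>R sym_part B))\<^sup>2)) *\<^sub>R B + c ^ 3 *\<^sub>R moment_flow_field B"
proof -
  have t: "trace (c *\<^sub>R B) = c * trace B" by (simp add: trace_def sum_distrib_left)
  have tr: "trace (sym_part (c *\<^sub>R B) ** sym_part (c *\<^sub>R B)) = (norm (c *\<^sub>R sym_part B))\<^sup>2"
    unfolding trace_sym_part_square by (simp only: sym_part_scaleR)
  show ?thesis
    unfolding bracket_flow_field_def tr moment_scaleR t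
    by (simp del: norm_scaleR add: moment_flow_field_def bounded_bilinear.scaleR_left[OF bounded_bilinear_commutator]
        bounded_bilinear.scaleR_right[OF bounded_bilinear_commutator] scaleR_right_diff_distrib
        power2_eq_square power3_eq_cube mult_ac)
qed

text \<open>Here \<open>B / \<mu>\<close> is a solution of the bracket flow.  The factor \<open>1 / \<mu>\<^sup>2\<close> is a change of time; it
  is kept explicit and controlled by the linear growth of \<open>\<mu>\<^sup>2\<close>.\<close>

locale normalized_moment_flow =
  fixes B :: "real \<Rightarrow> real^'n^'n" and \<mu> :: "real \<Rightarrow> real"
  assumes \<mu>0: "\<mu> 0 = 1" and \<mu>_pos: "\<And>t. \<mu> t > 0"
    and B': "\<And>t. t \<ge> 0 \<Longrightarrow> (B has_vector_derivative (1 / (\<mu> t)\<^sup>2) *\<^sub>R moment_flow_field (B t)) (at t within {0..})"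
    and \<mu>': "\<And>t. t \<ge> 0 \<Longrightarrow> ((\<lambda>t. (\<mu> t)\<^sup>2) has_real_derivative 2 * (norm (sym_part (B t)))\<^sup>2) (at t within {0..})"

text \<open>The scaling term \<open>- tr(S\<^sup>2) A\<close> is removed by the integrating factor \<open>\<mu> = exp (\<integral> tr(S\<^sup>2))\<close>; the other
  terms are homogeneous of degree three.\<close>

lemma normalized_flow:
  fixes A :: "real \<Rightarrow> real^'n^'n"
  assumes flow: "bracket_flow A0 A"
  obtains B \<mu> where "B 0 = A0" "\<And>t. A t = (1 / \<mu> t) *\<^sub>R B t" "normalized_moment_flow B \<mu>"
proof -
  have A0: "A 0 = A0" and A': "\<And>t. t \<ge> 0 \<Longrightarrow> (A has_vector_derivative bracket_flow_field (A t)) (at t within {0..})"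
    using flow by (auto simp: bracket_flow_def)
  have contA: "continuous_on {0..} A"
    using A' by (auto simp: continuous_on_eq_continuous_within intro: has_vector_derivative_continuous)
  define m where "m = (\<lambda>t. (norm (sym_part (A t)))\<^sup>2)"
  have "continuous_on {0..} (\<lambda>t. transpose (A t))"
    by (rule bounded_linear.continuous_on[OF bounded_linear_transpose contA])
  then have contm: "continuous_on {0..} m"
    unfolding m_def sym_part_def by (intro continuous_intros contA)
  define I where "I = (\<lambda>t. integral {0..t} m)"
  have I': "(I has_real_derivative m t) (at t within {0..})" if "t \<ge> 0" for t
  proof -
    have "(I has_vector_derivative m t) (at t within {0..t+1})"
      unfolding I_def using that
      by (intro integral_has_vector_derivative continuous_on_subset[OF contm]) auto
    moreover have "at t within {0..t+1} = at t within {0..}"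
      by (rule at_within_nhd[of _ "{..<t+1}"]) auto
    ultimately show ?thesis by (simp add: has_real_derivative_iff_has_vector_derivative)
  qed
  define \<mu> where "\<mu> = (\<lambda>t. exp (I t))"
  define B where "B = (\<lambda>t. \<mu> t *\<^sub>R A t)"
  have \<mu>': "(\<mu> has_real_derivative \<mu> t * m t) (at t within {0..})" if "t \<ge> 0" for t
    unfolding \<mu>_def using I'[OF that] by (auto intro!: derivative_eq_intros)
  have pos: "\<mu> t > 0" for t by (simp add: \<mu>_def)
  have AB: "A t = (1 / \<mu> t) *\<^sub>R B t" for t
    using pos[of t] by (simp add: B_def)
  have sB: "norm (sym_part (B t)) = \<mu> t * norm (sym_part (A t))" for t
    using pos[of t] by (simp add: B_def sym_part_scaleR)
  have \<mu>0: "\<mu> 0 = 1" by (simp add: \<mu>_def I_def)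
  then have B0: "B 0 = A0" by (simp add: B_def A0)
  have "normalized_moment_flow B \<mu>"
  proof
    show "\<mu> 0 = 1" by (rule \<mu>0)
    show "\<mu> t > 0" for t by (rule pos)
    fix t :: real assume t: "t \<ge> 0"
    have "(B has_vector_derivative (\<mu> t *\<^sub>R bracket_flow_field (A t) + (\<mu> t * m t) *\<^sub>R A t)) (at t within {0..})"
      unfolding B_def by (rule has_vector_derivative_scaleR[OF \<mu>'[OF t] A'[OF t]])
    moreover have "\<mu> t *\<^sub>R bracket_flow_field (A t) + (\<mu> t * m t) *\<^sub>R A t
        = (1 / (\<mu> t)\<^sup>2) *\<^sub>R moment_flow_field (B t)"
    proof -
      have "bracket_flow_field (A t) = (- (1 / \<mu> t * m t)) *\<^sub>R B t + (1 / \<mu> t) ^ 3 *\<^sub>R moment_flow_field (B t)"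
        unfolding m_def AB[of t] bracket_flow_field_scaleR sym_part_scaleR ..
      moreover have "\<mu> t * (1 / \<mu> t) ^ 3 = 1 / (\<mu> t)\<^sup>2"
        using pos[of t] by (simp add: field_simps power2_eq_square power3_eq_cube)
      ultimately show ?thesis
        using pos[of t] by (simp add: scaleR_right_distrib scaleR_right_diff_distrib AB[of t])
    qed
    ultimately show "(B has_vector_derivative (1 / (\<mu> t)\<^sup>2) *\<^sub>R moment_flow_field (B t)) (at t within {0..})"
      by simp
    show "((\<lambda>t. (\<mu> t)\<^sup>2) has_real_derivative 2 * (norm (sym_part (B t)))\<^sup>2) (at t within {0..})"
      using \<mu>'[OF t] unfolding sB
      by (auto intro!: derivative_eq_intros simp: m_def power2_eq_square)
  qed
  with B0 AB show ?thesis by (rule that)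
qed

text \<open>The real polynomial with the roots \<open>s \<plusminus> i \<surd>c\<close>, evaluated at a matrix: for \<open>c \<ge> 0\<close> it is singular
  exactly if one of these numbers is an eigenvalue, which allows complex spectra to be followed over the
  reals.\<close>

definition quad :: "real \<Rightarrow> real \<Rightarrow> real^'n^'n \<Rightarrow> real^'n^'n" where
  "quad s c X = (X - s *\<^sub>R mat 1) ** (X - s *\<^sub>R mat 1) + c *\<^sub>R mat 1"

context normalized_moment_flow
begin

lemma at_interior: "t > 0 \<Longrightarrow> at t within {0..} = at (t::real)"
  by (rule at_within_nhd[of _ "{0<..}"]) auto

lemma continuous_B: "continuous_on {0..} B"
  using B' by (auto simp: continuous_on_eq_continuous_within intro: has_vector_derivative_continuous)

lemma decreasing:
  fixes f :: "real \<Rightarrow> real"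
  assumes "0 \<le> s" "s \<le> t" "continuous_on {0..} f"
    and "\<And>r. s < r \<Longrightarrow> r < t \<Longrightarrow> (f has_real_derivative f' r) (at r)" "\<And>r. s < r \<Longrightarrow> r < t \<Longrightarrow> f' r \<le> 0"
  shows "f t \<le> f s"
proof (rule DERIV_nonpos_imp_decreasing_open[OF assms(2)])
  show "continuous_on {s..t} f" using assms(1) by (intro continuous_on_subset[OF assms(3)]) auto
qed (use assms in blast)

lemma norm_B_derivative:
  assumes "t > 0"
  shows "((\<lambda>t. (norm (B t))\<^sup>2) has_real_derivative - ((norm (moment (B t)))\<^sup>2 / (\<mu> t)\<^sup>2)) (at t)"
proof -
  have d: "(B has_vector_derivative (1 / (\<mu> t)\<^sup>2) *\<^sub>R moment_flow_field (B t)) (at t)"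
    using B'[of t] assms by (simp add: at_interior)
  have "((\<lambda>t. B t \<bullet> B t) has_vector_derivative
     (B t \<bullet> (1 / (\<mu> t)\<^sup>2) *\<^sub>R moment_flow_field (B t) + (1 / (\<mu> t)\<^sup>2) *\<^sub>R moment_flow_field (B t) \<bullet> B t)) (at t)"
    by (rule bounded_bilinear.has_vector_derivative[OF bounded_bilinear_inner d d])
  moreover have "B t \<bullet> moment_flow_field (B t) = - (norm (moment (B t)))\<^sup>2 / 2"
    by (simp add: moment_flow_field_def inner_diff_right inner_commutator_moment inner_moment power2_norm_eq_inner)
  ultimately show ?thesis
    by (simp add: has_real_derivative_iff_has_vector_derivative power2_norm_eq_inner inner_commute)
qed

text \<open>Up to rotations the flow is a gradient flow of \<open>|[B, B\<^sup>t]|\<^sup>2\<close>, which therefore decreases.\<close>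

lemma norm_moment_derivative:
  assumes "t > 0"
  shows "((\<lambda>t. (norm (moment (B t)))\<^sup>2) has_real_derivative
    - (2 * (norm (commutator (B t) (moment (B t))))\<^sup>2 / (\<mu> t)\<^sup>2)) (at t)"
proof -
  define H where "H = (1 / (\<mu> t)\<^sup>2) *\<^sub>R moment_flow_field (B t)"
  have d: "(B has_vector_derivative H) (at t)"
    using B'[of t] assms by (simp add: at_interior H_def)
  have "((\<lambda>t. moment (B t)) has_vector_derivative
     (commutator (B t) (transpose H) + commutator H (transpose (B t)))) (at t)"
    by (rule bounded_bilinear.has_vector_derivative[OF bounded_bilinear_commutator d
      bounded_linear.has_vector_derivative[OF bounded_linear_transpose d]])
  from bounded_bilinear.has_vector_derivative[OF bounded_bilinear_inner this this]
  have "((\<lambda>t. moment (B t) \<bullet> moment (B t)) has_vector_derivative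
     2 * (moment (B t) \<bullet> (commutator H (transpose (B t)) + commutator (B t) (transpose H)))) (at t)"
    by (simp add: inner_commute add.commute)
  moreover have "commutator (B t) (moment (B t)) \<bullet> H = (norm (commutator (B t) (moment (B t))))\<^sup>2 / 2 / (\<mu> t)\<^sup>2"
    by (simp add: H_def moment_flow_field_def inner_diff_right commutator_moment_inner_moment power2_norm_eq_inner)
  ultimately show ?thesis
    unfolding moment_inner_derivative
    by (simp add: has_real_derivative_iff_has_vector_derivative power2_norm_eq_inner)
qed

lemma continuous_moment: "continuous_on {0..} (\<lambda>t. moment (B t))"
  by (rule bounded_bilinear.continuous_on[OF bounded_bilinear_commutator continuous_B
    bounded_linear.continuous_on[OF bounded_linear_transpose continuous_B]])

lemma norm_B_le: "t \<ge> 0 \<Longrightarrow> norm (B t) \<le> norm (B 0)"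
proof -
  assume "t \<ge> 0"
  then have "(norm (B t))\<^sup>2 \<le> (norm (B 0))\<^sup>2"
    by (intro decreasing[where s = 0 and t = t and f = "\<lambda>t. (norm (B t))\<^sup>2", OF _ _ _ norm_B_derivative])
      (auto intro!: continuous_intros continuous_B)
  then show ?thesis by (rule power2_le_imp_le) simp
qed

lemma norm_moment_antimono:
  assumes "0 \<le> s" "s \<le> t"
  shows "(norm (moment (B t)))\<^sup>2 \<le> (norm (moment (B s)))\<^sup>2"
  by (rule decreasing[where s = s and t = t and f = "\<lambda>t. (norm (moment (B t)))\<^sup>2", OF assms _ norm_moment_derivative])
    (use assms in \<open>auto intro!: continuous_intros continuous_moment\<close>)

lemma continuous_\<mu>: "continuous_on {0..} (\<lambda>t. (\<mu> t)\<^sup>2)"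
  using \<mu>' by (intro DERIV_continuous_on[of _ _ "\<lambda>t. 2 * (norm (sym_part (B t)))\<^sup>2"]) auto

lemma \<mu>_le:
  assumes "t \<ge> 0"
  shows "(\<mu> t)\<^sup>2 \<le> 1 + 2 * (norm (B 0))\<^sup>2 * t"
proof -
  define f where "f = (\<lambda>t. (\<mu> t)\<^sup>2 - 2 * (norm (B 0))\<^sup>2 * t)"
  have "f t \<le> f 0"
  proof (rule decreasing[OF _ assms])
    show "continuous_on {0..} f" unfolding f_def by (intro continuous_intros continuous_\<mu>)
    fix r :: real assume r: "0 < r" "r < t"
    show "(f has_real_derivative 2 * (norm (sym_part (B r)))\<^sup>2 - 2 * (norm (B 0))\<^sup>2) (at r)"
      unfolding f_def using \<mu>'[of r] r
      by (intro DERIV_diff DERIV_cmult_Id) (simp add: at_interior)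
    have "norm (sym_part (B r)) \<le> norm (B 0)"
      using norm_sym_part_le[of "B r"] norm_B_le[of r] r by simp
    then show "2 * (norm (sym_part (B r)))\<^sup>2 - 2 * (norm (B 0))\<^sup>2 \<le> 0"
      by (simp add: power_mono)
  qed simp
  then show ?thesis by (simp add: f_def \<mu>0)
qed

text \<open>Since \<open>|[B, B\<^sup>t]|\<close> decreases, the loss of \<open>|B|\<^sup>2\<close> up to time \<open>t\<close> is at least
  \<open>|[B, B\<^sup>t]|\<^sup>2\<close> at time \<open>t\<close>, multiplied by the elapsed rescaled time \<open>\<integral> \<mu>\<^sup>-\<^sup>2\<close>.  The latter grows at
  least logarithmically, whereas the loss is bounded by the initial value.\<close>

lemma moment_decay:
  assumes "t \<ge> 0" and C: "C = (norm (B 0))\<^sup>2 + 1"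
  shows "(norm (moment (B t)))\<^sup>2 * ln (1 + 2 * C * t) \<le> 2 * C\<^sup>2"
proof -
  have C1: "C > 0" unfolding C by (simp add: add_nonneg_pos)
  define F where "F = (norm (moment (B t)))\<^sup>2"
  define f where "f = (\<lambda>s. (norm (B s))\<^sup>2 + F / (2 * C) * ln (1 + 2 * C * s))"
  have "f t \<le> f 0"
  proof (rule decreasing[OF _ assms(1)])
    have "1 + 2 * C * s \<noteq> 0" if "s \<ge> 0" for s :: real
      using that C1 by (smt (verit) mult_nonneg_nonneg)
    then show "continuous_on {0..} f"
      unfolding f_def using C1 by (intro continuous_intros continuous_B) auto
    fix r :: real assume r: "0 < r" "r < t"
    have p: "1 + 2 * C * r > 0" using r C1 by (simp add: add_pos_pos)
    show "(f has_real_derivative - ((norm (moment (B r)))\<^sup>2 / (\<mu> r)\<^sup>2) + F / (1 + 2 * C * r)) (at r)"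
      unfolding f_def
    proof (rule DERIV_add[OF norm_B_derivative[OF r(1)]])
      have "((\<lambda>s. ln (1 + 2 * C * s)) has_real_derivative 2 * C / (1 + 2 * C * r)) (at r)"
        using p by (auto intro!: derivative_eq_intros)
      from DERIV_cmult[OF this, of "F / (2 * C)"]
      show "((\<lambda>s. F / (2 * C) * ln (1 + 2 * C * s)) has_real_derivative F / (1 + 2 * C * r)) (at r)"
        using C1 by simp
    qed
    have "(\<mu> r)\<^sup>2 \<le> 1 + 2 * (norm (B 0))\<^sup>2 * r" using \<mu>_le r by simp
    also have "\<dots> \<le> 1 + 2 * C * r" using r by (simp add: C mult_right_mono)
    finally have "F / (1 + 2 * C * r) \<le> F / (\<mu> r)\<^sup>2"
      using \<mu>_pos[of r] by (intro divide_left_mono) (auto simp: F_def intro!: mult_pos_pos p)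
    also have "\<dots> \<le> (norm (moment (B r)))\<^sup>2 / (\<mu> r)\<^sup>2"
      unfolding F_def using norm_moment_antimono[of r t] r by (intro divide_right_mono) auto
    finally show "- ((norm (moment (B r)))\<^sup>2 / (\<mu> r)\<^sup>2) + F / (1 + 2 * C * r) \<le> 0" by simp
  qed simp
  then have "F / (2 * C) * ln (1 + 2 * C * t) \<le> (norm (B 0))\<^sup>2"
    by (simp add: f_def) (smt (verit) zero_le_power2)
  also have "\<dots> \<le> C" by (simp add: C)
  finally have "F * ln (1 + 2 * C * t) / (2 * C) \<le> C" by simp
  then have "F * ln (1 + 2 * C * t) \<le> C * (2 * C)" using C1 by (simp add: pos_divide_le_eq)
  then show ?thesis by (simp add: F_def power2_eq_square mult_ac)
qed

lemma moment_tendsto_0: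
  assumes "\<delta> > 0"
  obtains s0 where "s0 \<ge> 0" "\<And>t. t \<ge> s0 \<Longrightarrow> norm (moment (B t)) < \<delta>"
proof -
  define C where "C = (norm (B 0))\<^sup>2 + 1"
  have C: "C > 0" unfolding C_def by (simp add: add_nonneg_pos)
  define s0 where "s0 = exp (2 * C\<^sup>2 / \<delta>\<^sup>2) / (2 * C)"
  have s0: "s0 > 0" using C by (simp add: s0_def)
  have "norm (moment (B t)) < \<delta>" if t: "t \<ge> s0" for t
  proof (rule ccontr)
    assume "\<not> norm (moment (B t)) < \<delta>"
    then have le: "\<delta>\<^sup>2 \<le> (norm (moment (B t)))\<^sup>2"
      using assms by (intro power_mono) auto
    have "exp (2 * C\<^sup>2 / \<delta>\<^sup>2) = 2 * C * s0" using C by (simp add: s0_def)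
    also have "\<dots> \<le> 2 * C * t" using t C by (simp add: mult_left_mono)
    also have "\<dots> < 1 + 2 * C * t" by simp
    finally have "exp (2 * C\<^sup>2 / \<delta>\<^sup>2) < 1 + 2 * C * t" .
    then have l: "2 * C\<^sup>2 / \<delta>\<^sup>2 < ln (1 + 2 * C * t)"
      by (metis exp_gt_zero exp_less_cancel_iff exp_ln less_trans)
    then have "2 * C\<^sup>2 < \<delta>\<^sup>2 * ln (1 + 2 * C * t)"
      using assms by (simp add: pos_divide_less_eq mult.commute)
    also have "\<dots> \<le> (norm (moment (B t)))\<^sup>2 * ln (1 + 2 * C * t)"
    proof (rule mult_right_mono[OF le])
      have "0 \<le> 2 * C\<^sup>2 / \<delta>\<^sup>2" by simp
      with l show "0 \<le> ln (1 + 2 * C * t)" by linarith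
    qed
    also have "\<dots> \<le> 2 * C\<^sup>2" using moment_decay[OF _ C_def, of t] s0 t by simp
    finally show False by simp
  qed
  with s0 show ?thesis by (intro that[of s0]) auto
qed

text \<open>The equation for \<open>B\<close> has the Lax form \<open>B' = [B, V]\<close>, and \<open>[\<cdot>, V]\<close> is a derivation, so every
  polynomial in \<open>B\<close> satisfies the same equation.\<close>

lemma det_quad_invariant:
  assumes "t \<ge> 0"
  shows "det (quad s c (B t)) = det (quad s c (B 0))"
proof (cases "t = 0")
  case False
  note bm = bounded_bilinear_matrix_mult
  note mm = bounded_bilinear.has_vector_derivative[OF bm]
  have cont: "continuous_on {0..} (\<lambda>t. det (quad s c (B t)))"
  proof -
    have "continuous_on UNIV (det :: real^'n^'n \<Rightarrow> real)"
      by (rule differentiable_imp_continuous_on) (simp add: differentiable_on_def det_differentiable)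
    moreover have "continuous_on {0..} (\<lambda>t. quad s c (B t))"
      unfolding quad_def
      by (intro continuous_intros bounded_bilinear.continuous_on[OF bm] continuous_B)
    ultimately show ?thesis by (rule continuous_on_compose2) auto
  qed
  have "((\<lambda>t. det (quad s c (B t))) has_real_derivative 0) (at r)" if "0 < r" for r
  proof (rule det_conj_derivative)
    define V where "V = (1 / (\<mu> r)\<^sup>2) *\<^sub>R ((1/2) *\<^sub>R moment (B r) - (trace (B r) / 2) *\<^sub>R transpose (B r))"
    have H: "(1 / (\<mu> r)\<^sup>2) *\<^sub>R moment_flow_field (B r) = commutator (B r) V"
      by (simp add: V_def moment_flow_field_def bounded_bilinear.diff_right[OF bounded_bilinear_commutator]
        bounded_bilinear.scaleR_right[OF bounded_bilinear_commutator])
    have "(B has_vector_derivative commutator (B r) V) (at r)"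
      using B'[of r] that by (simp add: at_interior H)
    then have d: "((\<lambda>t. B t - s *\<^sub>R mat 1) has_vector_derivative commutator (B r) V) (at r)"
      by (auto intro!: derivative_eq_intros)
    have "((\<lambda>t. quad s c (B t)) has_vector_derivative
       ((B r - s *\<^sub>R mat 1) ** commutator (B r) V + commutator (B r) V ** (B r - s *\<^sub>R mat 1)) + 0) (at r)"
      unfolding quad_def by (rule has_vector_derivative_add[OF mm[OF d d] has_vector_derivative_const])
    also have "((B r - s *\<^sub>R mat 1) ** commutator (B r) V + commutator (B r) V ** (B r - s *\<^sub>R mat 1)) + 0
      = commutator (quad s c (B r)) V"
      by (simp add: commutator_def quad_def bounded_bilinear.diff_left[OF bm] bounded_bilinear.diff_right[OF bm]
         bounded_bilinear.add_left[OF bm] bounded_bilinear.add_right[OF bm]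
         bounded_bilinear.scaleR_left[OF bm] bounded_bilinear.scaleR_right[OF bm] matrix_mul_assoc)
        (simp add: algebra_simps)
    finally show "((\<lambda>t. quad s c (B t)) has_vector_derivative commutator (quad s c (B r)) V) (at r)" .
  qed
  then show ?thesis
    using DERIV_isconst_end[of 0 t "\<lambda>t. det (quad s c (B t))"] assms False
      continuous_on_subset[OF cont, of "{0..t}"] by auto
qed simp

end

section \<open>Eigenvalues in the closed left half plane\<close>

text \<open>The minimum of the Rayleigh quotient on an invariant subspace is attained at an eigenvector:
  otherwise moving the minimiser \<open>x\<close> against \<open>z = M x - m x\<close> would decrease it.\<close>

lemma self_adjoint_min_eigenvector:
  fixes M :: "'a::euclidean_space \<Rightarrow> 'a"
  assumes M: "linear M" and E: "subspace E" "E \<noteq> {0}"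
    and ME: "\<And>x. x \<in> E \<Longrightarrow> M x \<in> E"
    and sa: "\<And>x y. x \<in> E \<Longrightarrow> y \<in> E \<Longrightarrow> M x \<bullet> y = x \<bullet> M y"
  obtains x m where "x \<in> E" "norm x = 1" "M x = m *\<^sub>R x" "\<And>y. y \<in> E \<Longrightarrow> m * (y \<bullet> y) \<le> M y \<bullet> y"
proof -
  let ?K = "E \<inter> sphere 0 1"
  have K: "compact ?K"
    using closed_subspace[OF E(1)] by (simp add: closed_Int_compact)
  obtain e where "e \<in> E" "e \<noteq> 0" using E subspace_0 by blast
  then have "(1 / norm e) *\<^sub>R e \<in> ?K" using subspace_scale[OF E(1)] by auto
  then have ne: "?K \<noteq> {}" by blast
  have "continuous_on ?K (\<lambda>x. M x \<bullet> x)"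
    by (intro continuous_intros linear_continuous_on) (use M linear_linear in blast)
  from continuous_attains_inf[OF K ne this]
  obtain x where x: "x \<in> E" "norm x = 1" and min: "\<And>y. y \<in> E \<Longrightarrow> norm y = 1 \<Longrightarrow> M x \<bullet> x \<le> M y \<bullet> y"
    by auto
  define m where "m = M x \<bullet> x"
  have le: "m * (y \<bullet> y) \<le> M y \<bullet> y" if "y \<in> E" for y
  proof (cases "y = 0")
    case False
    have "m \<le> M ((1 / norm y) *\<^sub>R y) \<bullet> ((1 / norm y) *\<^sub>R y)"
      unfolding m_def using False that by (intro min subspace_scale[OF E(1)]) auto
    also have "\<dots> = M y \<bullet> y / (y \<bullet> y)"
      by (simp add: linear_cmul[OF M] power2_norm_eq_inner[symmetric] power2_eq_square)
    finally show ?thesis using False by (simp add: pos_le_divide_eq)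
  qed simp
  have "M x = m *\<^sub>R x"
  proof (rule ccontr)
    assume "M x \<noteq> m *\<^sub>R x"
    define z where "z = M x - m *\<^sub>R x"
    define c q where "c = z \<bullet> z" and "q = M z \<bullet> z - m * (z \<bullet> z)"
    have zE: "z \<in> E" unfolding z_def using x ME by (intro subspace_diff[OF E(1)] subspace_scale[OF E(1)])
    have c: "c > 0" using \<open>M x \<noteq> m *\<^sub>R x\<close> by (simp add: c_def z_def)
    have q: "q \<ge> 0" using le[OF zE] by (simp add: q_def)
    have xx: "x \<bullet> x = 1" using x(2) by (simp add: dot_square_norm)
    \<comment> \<open>The first-order gain \<open>2 e c\<close> beats the second-order loss \<open>e\<^sup>2 q\<close> once \<open>e q < c\<close>.\<close>
    define e where "e = c / (q + 1)"
    have e: "e > 0" using c q by (simp add: e_def)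
    have "x - e *\<^sub>R z \<in> E" using x zE by (intro subspace_diff[OF E(1)] subspace_scale[OF E(1)])
    from le[OF this]
    have "m * ((x - e *\<^sub>R z) \<bullet> (x - e *\<^sub>R z)) \<le> M (x - e *\<^sub>R z) \<bullet> (x - e *\<^sub>R z)" .
    moreover have "M z \<bullet> x = M x \<bullet> z" using sa[OF zE x(1)] by (simp add: inner_commute)
    moreover have "M x \<bullet> z - m * (x \<bullet> z) = c"
      by (simp add: c_def z_def inner_diff_left)
    moreover have "x \<bullet> M x = m" by (simp add: m_def inner_commute)
    ultimately have "2 * e * c \<le> e * (e * q)"
      by (simp add: linear_diff[OF M] linear_cmul[OF M] inner_diff_left inner_diff_right q_def
          xx inner_commute algebra_simps)
    then have "2 * c \<le> e * q" using e by (simp add: mult.assoc mult.left_commute)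
    also have "\<dots> < c" using c q by (simp add: e_def field_simps)
    finally show False using c by simp
  qed
  with x le show ?thesis using that by blast
qed

lemma det_eq_0_iff_kernel:
  fixes M :: "real^'n^'n"
  shows "det M = 0 \<longleftrightarrow> (\<exists>x. x \<noteq> 0 \<and> M *v x = 0)"
  by (metis invertible_det_nz invertible_left_inverse matrix_left_invertible_ker)

text \<open>A normal matrix has commuting symmetric and skew parts \<open>S\<close> and \<open>T\<close>, and then \<open>S x\<close> is orthogonal to
  \<open>T x\<close>.  Hence each failure of the curvature conditions gives \<open>\<langle>S x, x\<rangle> \<le> 0\<close> and so an eigenvalue \<open>s \<le> 0\<close>
  of \<open>S\<close>.  Its eigenspace is invariant under \<open>T\<close>, where \<open>- T\<^sup>2\<close> is self-adjoint and nonnegative with an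
  eigenvalue \<open>c\<close>; together these form an eigenvalue \<open>s \<plusminus> i \<surd>c\<close> of the matrix in the closed left half plane.\<close>

lemma normal_kernel:
  fixes B :: "real^'n^'n"
  assumes normal: "moment B = 0" and x: "x \<noteq> 0"
    and bad: "(sym_part B *v x) \<bullet> x \<le> 0 \<or> 2 * ((sym_part B *v x) \<bullet> (B *v x)) \<le> (sym_part B *v x) \<bullet> (sym_part B *v x)"
  obtains s c where "s \<le> 0" "c \<ge> 0" "det (quad s c B) = 0"
proof -
  define L L' where "L = (\<lambda>x. B *v x)" and "L' = (\<lambda>x. transpose B *v x)"
  define S where "S = (\<lambda>x. sym_part B *v x)"
  define T where "T = (\<lambda>x. L x - S x)"
  have lin: "linear L" "linear L'" "linear S"
    by (simp_all add: L_def L'_def S_def matrix_vector_mul_linear del: transpose_matrix_vector)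
  have linT: "linear T" unfolding T_def by (intro linear_compose_sub lin)
  have S: "S x = (1/2) *\<^sub>R (L x + L' x)" for x
    unfolding S_def L_def L'_def sym_part_def
    by (metis scaleR_matrix_vector_assoc matrix_vector_mult_add_rdistrib)
  have T: "T x = (1/2) *\<^sub>R (L x - L' x)" for x
    by (simp add: T_def S vec_eq_iff field_simps)
  have comm: "L (L' x) = L' (L x)" for x
  proof -
    have "B ** transpose B = transpose B ** B" using normal by (simp add: commutator_def)
    then show ?thesis unfolding L_def L'_def matrix_vector_mul_assoc by simp
  qed
  have adj: "L x \<bullet> y = x \<bullet> L' y" "L' x \<bullet> y = x \<bullet> L y" for x y
    unfolding L_def L'_def using transpose_inner[of B y x] transpose_inner[of B x y] by (simp_all only: inner_commute)
  have Ssym: "S x \<bullet> y = x \<bullet> S y" for x y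
    by (simp add: S adj inner_add_left inner_add_right add.commute)
  have Tskew: "T x \<bullet> y = - (x \<bullet> T y)" for x y
    by (simp add: T adj inner_diff_left inner_diff_right field_simps)
  have ST: "S (T x) = T (S x)" for x
    by (simp add: S T linear_add[OF lin(1)] linear_add[OF lin(2)] linear_diff[OF lin(1)] linear_diff[OF lin(2)]
        linear_cmul[OF lin(1)] linear_cmul[OF lin(2)] comm algebra_simps)
  have orth: "S x \<bullet> T x = 0"
    using Ssym[of x "T x"] Tskew[of x "S x"] ST[of x] by (simp add: inner_commute)
  have Sx: "S x \<bullet> x \<le> 0"
  proof -
    have "S x \<bullet> L x = S x \<bullet> S x" using orth by (simp add: T_def inner_diff_right)
    with bad have "S x \<bullet> x \<le> 0 \<or> S x \<bullet> S x \<le> 0" by (auto simp: S_def L_def)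
    then show ?thesis by (metis inner_gt_zero_iff inner_zero_left not_le order_refl)
  qed
  obtain e s where e: "norm e = 1" "S e = s *\<^sub>R e" and s: "\<And>y. s * (y \<bullet> y) \<le> S y \<bullet> y"
    using self_adjoint_min_eigenvector[OF lin(3) subspace_UNIV _ _ Ssym]
    by (metis UNIV_I UNIV_not_singleton)
  have "s * (x \<bullet> x) \<le> 0" using s[of x] Sx by linarith
  moreover have "x \<bullet> x > 0" using x by simp
  ultimately have s0: "s \<le> 0" by (meson mult_pos_pos not_le)
  define E where "E = {y. S y = s *\<^sub>R y}"
  have subE: "subspace E"
    by (simp add: E_def subspace_def linear_add[OF lin(3)] linear_cmul[OF lin(3)] linear_0[OF lin(3)] scaleR_add_right)
  have TE: "T y \<in> E" if "y \<in> E" for y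
    using that by (simp add: E_def ST linear_cmul[OF linT])
  have linTT: "linear (\<lambda>x. - T (T x))"
    using linear_compose_neg[OF linear_compose[OF linT linT]] by (simp add: o_def)
  have "e \<in> E" "e \<noteq> 0" using e by (simp add: E_def, metis norm_zero zero_neq_one)
  then have ne: "E \<noteq> {0}" by blast
  obtain y c where y: "y \<in> E" "norm y = 1" "- T (T y) = c *\<^sub>R y"
  proof (rule self_adjoint_min_eigenvector[OF linTT subE ne])
    show "- T (T z) \<in> E" if "z \<in> E" for z by (rule subspace_neg[OF subE TE[OF TE[OF that]]])
    show "- T (T z) \<bullet> w = z \<bullet> - T (T w)" for z w by (simp add: Tskew)
    show thesis if "z \<in> E" "norm z = 1" "- T (T z) = m *\<^sub>R z" for z m
      using that by (rule \<open>\<And>y c. y \<in> E \<Longrightarrow> norm y = 1 \<Longrightarrow> - T (T y) = c *\<^sub>R y \<Longrightarrow> thesis\<close>)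
  qed
  have "c = T y \<bullet> T y"
    using arg_cong[OF y(3), of "\<lambda>w. w \<bullet> y"] y(2) Tskew[of "T y" y] by (simp add: dot_square_norm)
  then have c0: "c \<ge> 0" by simp
  have Ty: "(B - s *\<^sub>R mat 1) *v z = T z" if "z \<in> E" for z
    using that by (simp add: T_def L_def E_def matrix_vector_mult_diff_rdistrib flip: scaleR_matrix_vector_assoc)
  have "quad s c B *v y = (B - s *\<^sub>R mat 1) *v ((B - s *\<^sub>R mat 1) *v y) + c *\<^sub>R y"
    by (simp add: quad_def matrix_vector_mult_add_rdistrib
        flip: scaleR_matrix_vector_assoc matrix_vector_mul_assoc)
  also have "\<dots> = T (T y) + c *\<^sub>R y"
    by (simp only: Ty[OF y(1)] Ty[OF TE[OF y(1)]])
  also have "\<dots> = 0" by (simp only: y(3)[symmetric] add.right_inverse)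
  finally have "quad s c B *v y = 0" .
  then have "det (quad s c B) = 0"
    unfolding det_eq_0_iff_kernel using y(2) by (intro exI[of _ y]) auto
  then show ?thesis using that s0 c0 by blast
qed

text \<open>Lyapunov's argument that \<open>A\<close> has no eigenvalue in the closed left half plane.  For \<open>x\<close> in the
  kernel and \<open>y = (A - s) x\<close> one has \<open>(A - s) y = - c x\<close>; so \<open>P (y, x)\<close> and \<open>- c P (x, y)\<close> would both be
  positive.\<close>

lemma Lyapunov_det_quad:
  fixes A :: "real^'n^'n"
  assumes P: "bilinear P" "\<And>x. x \<noteq> 0 \<Longrightarrow> P x x > (0::real)" "\<And>x. x \<noteq> 0 \<Longrightarrow> P (A *v x) x > 0"
    and sym: "\<And>x y. P x y = P y x" and "s \<le> 0" "c \<ge> 0"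
  shows "det (quad s c A) \<noteq> 0"
proof
  assume "det (quad s c A) = 0"
  then obtain x where x: "x \<noteq> 0" "quad s c A *v x = 0"
    unfolding det_eq_0_iff_kernel by (elim exE conjE)
  define y where "y = A *v x - s *\<^sub>R x"
  have "(A - s *\<^sub>R mat 1) *v z = A *v z - s *\<^sub>R z" for z
    by (simp add: matrix_vector_mult_diff_rdistrib flip: scaleR_matrix_vector_assoc)
  then have y2: "A *v y - s *\<^sub>R y = - (c *\<^sub>R x)"
    using x(2) by (simp add: quad_def y_def matrix_vector_mult_add_rdistrib eq_neg_iff_add_eq_0
        flip: scaleR_matrix_vector_assoc matrix_vector_mul_assoc)
  have pos: "P (A *v z - s *\<^sub>R z) z > 0" if "z \<noteq> 0" for z
  proof -
    have "P (A *v z - s *\<^sub>R z) z = P (A *v z) z - s * P z z"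
      by (simp add: bilinear_lsub[OF P(1)] bilinear_lmul[OF P(1)])
    moreover have "s * P z z \<le> 0" using P(2)[OF that] \<open>s \<le> 0\<close> by (simp add: mult_le_0_iff)
    ultimately show ?thesis using P(3)[OF that] by linarith
  qed
  have "P y x > 0" using pos[OF x(1)] by (simp add: y_def)
  then have nonneg: "0 \<le> c * P x y" using sym[of x y] \<open>c \<ge> 0\<close> by simp
  have "y \<noteq> 0" using \<open>P y x > 0\<close> bilinear_lzero[OF P(1)] by auto
  from pos[OF this] have "c * P x y < 0"
    by (simp add: y2 bilinear_lneg[OF P(1)] bilinear_lmul[OF P(1)])
  with nonneg show False by simp
qed

section \<open>Negative curvature along the bracket flow\<close>

text \<open>The hypotheses of \<open>negative_curvature_gmetricI\<close> with the positive sign.\<close>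

definition negative_curvature_condition :: "real^'n^'n \<Rightarrow> bool" where
  "negative_curvature_condition B \<longleftrightarrow> (\<forall>x. x \<noteq> 0 \<longrightarrow>
     0 < (sym_part B *v x) \<bullet> x \<and>
     (sym_part B *v x) \<bullet> (sym_part B *v x) < 2 * ((sym_part B *v x) \<bullet> (B *v x)))"

text \<open>Compactness: the matrices of bounded norm with the spectral data of \<open>A0\<close>, paired with a unit
  vector at which a condition fails, form a compact set.  By \<open>normal_kernel\<close> it contains no normal matrix,
  so \<open>|[B, B\<^sup>t]|\<close> has a positive minimum on it.\<close>

lemma small_moment_imp_negative_curvature_condition:
  fixes A0 :: "real^'n^'n"
  assumes A0: "\<And>s c. s \<le> 0 \<Longrightarrow> c \<ge> 0 \<Longrightarrow> det (quad s c A0) \<noteq> 0"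
  shows "\<exists>\<delta>>0. \<forall>B :: real^'n^'n. norm B \<le> R \<and> (\<forall>s c. det (quad s c B) = det (quad s c A0)) \<and> norm (moment B) < \<delta>
    \<longrightarrow> negative_curvature_condition B"
proof -
  define bad where "bad = (\<lambda>(B :: real^'n^'n) (x :: real^'n). (sym_part B *v x) \<bullet> x \<le> 0
    \<or> 2 * ((sym_part B *v x) \<bullet> (B *v x)) \<le> (sym_part B *v x) \<bullet> (sym_part B *v x))"
  define K where "K = {z :: (real^'n^'n) \<times> (real^'n). norm (fst z) \<le> R \<and> norm (snd z) = 1
     \<and> (\<forall>s c. det (quad s c (fst z)) = det (quad s c A0)) \<and> bad (fst z) (snd z)}"
  note bm = bounded_bilinear.continuous_on[OF bounded_bilinear_matrix_mult]
  note bv = bounded_bilinear.continuous_on[OF bounded_bilinear_matrix_vector_mult]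
  note ct = bounded_linear.continuous_on[OF bounded_linear_transpose]
  have cdet: "continuous_on UNIV (\<lambda>z. det (f z))" if "continuous_on UNIV f"
    for f :: "(real^'n^'n) \<times> (real^'n) \<Rightarrow> real^'n^'n"
  proof (rule continuous_on_compose2[OF _ that])
    show "continuous_on UNIV (det :: real^'n^'n \<Rightarrow> real)"
      by (rule differentiable_imp_continuous_on) (simp add: differentiable_on_def det_differentiable)
  qed auto
  have "closed K"
    unfolding K_def bad_def quad_def sym_part_def
    by (intro closed_Collect_conj closed_Collect_all closed_Collect_disj closed_Collect_le closed_Collect_eq
      continuous_intros cdet bm bv ct)
  moreover have "K \<subseteq> cball 0 R \<times> cball 0 1" by (auto simp: K_def)
  then have "bounded K" by (rule bounded_subset[OF bounded_Times[OF bounded_cball bounded_cball]])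
  ultimately have K: "compact K" by (simp add: compact_eq_bounded_closed)
  have pos: "moment (fst z) \<noteq> 0" if "z \<in> K" for z
  proof
    assume "moment (fst z) = 0"
    moreover have "snd z \<noteq> 0" "bad (fst z) (snd z)" using that by (auto simp: K_def)
    ultimately obtain s c where "s \<le> 0" "c \<ge> 0" "det (quad s c (fst z)) = 0"
      unfolding bad_def by (rule normal_kernel)
    moreover have "det (quad s c (fst z)) = det (quad s c A0)" for s c using that by (auto simp: K_def)
    ultimately show False using A0 by metis
  qed
  obtain \<delta> where \<delta>: "\<delta> > 0" "\<And>z. z \<in> K \<Longrightarrow> \<delta> \<le> norm (moment (fst z))"
  proof (cases "K = {}")
    case True
    then show ?thesis using that[of 1] by simp
  next
    case False
    have "continuous_on K (\<lambda>z. norm (moment (fst z)))"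
      by (intro continuous_intros bounded_bilinear.continuous_on[OF bounded_bilinear_commutator] ct)
    from continuous_attains_inf[OF K False this]
    obtain z where "z \<in> K" "\<And>w. w \<in> K \<Longrightarrow> norm (moment (fst z)) \<le> norm (moment (fst w))" by blast
    with pos show ?thesis using that[of "norm (moment (fst z))"] by simp
  qed
  have *: "negative_curvature_condition B"
    if B: "norm B \<le> R" "\<forall>s c. det (quad s c B) = det (quad s c A0)" "norm (moment B) < \<delta>" for B :: "real^'n^'n"
    unfolding negative_curvature_condition_def
  proof (intro allI impI)
    fix x :: "real^'n" assume x: "x \<noteq> 0"
    define p u where "p = norm x" and "u = (1 / norm x) *\<^sub>R x"
    have p: "p > 0" and x_eq: "x = p *\<^sub>R u" using x by (simp_all add: u_def p_def)
    have "(B, u) \<notin> K" using \<delta>(2)[of "(B, u)"] B(3) by auto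
    then have "\<not> bad B u" using B x by (auto simp: K_def u_def)
    then have "(sym_part B *v u) \<bullet> u > 0"
      "(sym_part B *v u) \<bullet> (sym_part B *v u) < 2 * ((sym_part B *v u) \<bullet> (B *v u))"
      by (auto simp: bad_def)
    then have "p * (p * ((sym_part B *v u) \<bullet> u)) > 0"
      "p * (p * ((sym_part B *v u) \<bullet> (sym_part B *v u))) < p * (p * (2 * ((sym_part B *v u) \<bullet> (B *v u))))"
      using p by (simp_all only: mult_pos_pos mult_less_cancel_left_pos)
    then show "0 < (sym_part B *v x) \<bullet> x \<and>
        (sym_part B *v x) \<bullet> (sym_part B *v x) < 2 * ((sym_part B *v x) \<bullet> (B *v x))"
      unfolding x_eq by (simp add: matrix_vector_mult_scaleR mult.left_commute)
  qed
  show ?thesis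
    by (intro exI[of _ \<delta>] conjI allI impI \<delta>(1)) (elim conjE, rule *)
qed

lemma negative_curvature_condition_scaleR:
  assumes "c > 0" "negative_curvature_condition B"
  shows "negative_curvature_condition (c *\<^sub>R B)"
  using assms
  by (auto simp: negative_curvature_condition_def sym_part_scaleR mult.left_commute
      simp flip: scaleR_matrix_vector_assoc)

lemma bracket_flow_eventually_condition:
  fixes A0 :: "real^'n^'n"
  assumes P: "bilinear P" "\<And>x y. P x y = P y x" "\<And>x. x \<noteq> 0 \<Longrightarrow> P x x > (0::real)"
      "\<And>x. x \<noteq> 0 \<Longrightarrow> P (A0 *v x) x > 0"
    and flow: "bracket_flow A0 A"
  shows "\<exists>s0\<ge>0. \<forall>t\<ge>s0. negative_curvature_condition (A t)"
proof -
  obtain B \<mu> where B0: "B 0 = A0" and AB: "\<And>t. A t = (1 / \<mu> t) *\<^sub>R B t"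
    and nf: "normalized_moment_flow B \<mu>"
    using normalized_flow[OF flow] by metis
  interpret normalized_moment_flow B \<mu> by (rule nf)
  have "\<exists>\<delta>>0. \<forall>B :: real^'n^'n. norm B \<le> norm A0 \<and> (\<forall>s c. det (quad s c B) = det (quad s c A0)) \<and> norm (moment B) < \<delta>
      \<longrightarrow> negative_curvature_condition B"
    by (rule small_moment_imp_negative_curvature_condition) (rule Lyapunov_det_quad[OF P(1,3,4,2)])
  then obtain \<delta> where \<delta>: "\<delta> > 0" "\<forall>B :: real^'n^'n. norm B \<le> norm A0 \<and> (\<forall>s c. det (quad s c B) = det (quad s c A0)) \<and> norm (moment B) < \<delta>
      \<longrightarrow> negative_curvature_condition B"
    by (elim exE conjE)
  obtain s0 where s0: "s0 \<ge> 0" "\<And>t. t \<ge> s0 \<Longrightarrow> norm (moment (B t)) < \<delta>"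
    using moment_tendsto_0[OF \<delta>(1)] by metis
  have "negative_curvature_condition (A t)" if t: "t \<ge> s0" for t
  proof -
    have t0: "t \<ge> 0" using t s0(1) by simp
    have "negative_curvature_condition (B t)"
      by (rule \<delta>(2)[THEN spec, THEN mp])
        (simp add: s0(2)[OF t] norm_B_le[OF t0, unfolded B0] det_quad_invariant[OF t0, unfolded B0])
    then show ?thesis unfolding AB using \<mu>_pos[of t] by (intro negative_curvature_condition_scaleR) auto
  qed
  with s0(1) show ?thesis by blast
qed

text \<open>All terms of the flow are odd in \<open>A\<close>.\<close>

lemma bracket_flow_uminus:
  fixes A0 :: "real^'n^'n"
  assumes "bracket_flow A0 A"
  shows "bracket_flow (- A0) (\<lambda>t. - A t)"
proof -
  have tp: "transpose (- X) = - transpose X" for X :: "real^'n^'n" by (simp add: transpose_def vec_eq_iff)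
  have "trace (- X) = - trace X" for X :: "real^'n^'n" by (simp add: trace_def sum_negf)
  moreover have "sym_part (- X) = - sym_part X" for X :: "real^'n^'n" using sym_part_scaleR[of "-1" X] by simp
  moreover have "(- X) ** (- Y) = X ** Y" for X Y :: "real^'n^'n"
    by (simp add: bounded_bilinear.minus_left[OF bounded_bilinear_matrix_mult] bounded_bilinear.minus_right[OF bounded_bilinear_matrix_mult])
  ultimately have "bracket_flow_field (- X) = - bracket_flow_field X" for X :: "real^'n^'n"
    by (simp add: bracket_flow_field_def tp bounded_bilinear.minus_left[OF bounded_bilinear_commutator]
      bounded_bilinear.minus_right[OF bounded_bilinear_commutator])
  then show ?thesis
    using assms by (auto simp: bracket_flow_def intro: has_vector_derivative_minus)
qed

theorem theorem6p5:
  fixes A\<^sub>0 :: "real^'n^'n" and A :: "real \<Rightarrow> real^'n^'n"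
  assumes "\<exists>g. riemannian_metric g \<and> left_invariant A\<^sub>0 g \<and> negative_curvature g"
    and "bracket_flow A\<^sub>0 A"
  shows "\<exists>s\<^sub>0\<ge>0. \<forall>t\<ge>s\<^sub>0. negative_curvature (gmetric (A t))"
proof -
  obtain g where g: "riemannian_metric g" "left_invariant A\<^sub>0 g" "negative_curvature g"
    using assms(1) by (elim exE conjE)
  obtain P :: "real^'n \<Rightarrow> real^'n \<Rightarrow> real" and \<sigma> :: real
    where P: "bilinear P" "\<And>x y. P x y = P y x" "\<And>x. x \<noteq> 0 \<Longrightarrow> P x x > 0"
      and \<sigma>: "\<And>x. x \<noteq> 0 \<Longrightarrow> \<sigma> * P (A\<^sub>0 *v x) x > 0"
    using Heintze_necessary[OF g] by metis
  show ?thesis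
  proof (cases "\<sigma> > 0")
    case True
    then have "P (A\<^sub>0 *v x) x > 0" if "x \<noteq> 0" for x
      using \<sigma>[OF that] by (simp add: zero_less_mult_iff)
    from bracket_flow_eventually_condition[OF P this assms(2)]
    obtain s0 where "s0 \<ge> 0" "\<And>t. t \<ge> s0 \<Longrightarrow> negative_curvature_condition (A t)" by blast
    moreover have "negative_curvature (gmetric X)" if "negative_curvature_condition X" for X :: "real^'n^'n"
      using that by (intro negative_curvature_gmetricI[of 1]) (simp_all add: negative_curvature_condition_def)
    ultimately show ?thesis by blast
  next
    case False
    have neg: "(- X) *v x = - (X *v x)" for X :: "real^'n^'n" and x
      by (simp add: bounded_bilinear.minus_left[OF bounded_bilinear_matrix_vector_mult])
    have "P ((- A\<^sub>0) *v x) x > 0" if "x \<noteq> 0" for x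
      using \<sigma>[OF that] False by (simp add: neg bilinear_lneg[OF P(1)] zero_less_mult_iff)
    from bracket_flow_eventually_condition[OF P this bracket_flow_uminus[OF assms(2)]]
    obtain s0 where "s0 \<ge> 0" "\<And>t. t \<ge> s0 \<Longrightarrow> negative_curvature_condition (- A t)" by blast
    moreover have "sym_part (- X) = - sym_part X" for X :: "real^'n^'n"
      using sym_part_scaleR[of "-1" X] by simp
    then have "negative_curvature (gmetric X)" if "negative_curvature_condition (- X)" for X :: "real^'n^'n"
      using that by (intro negative_curvature_gmetricI[of "-1"]) (simp_all add: negative_curvature_condition_def neg)
    ultimately show ?thesis by blast
  qed
qed

end
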